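(* Let $n$ be a positive integer. Any graph $G\in G_{n,n}$ is 2-connected and Hamiltonian.
   Context: All graphs are finite and simple. For a positive integer $n$, $G_{n,n}$ denotes the class of all simple graphs that have the same degree sequence as the disjoint union $K_n\cup K_n$ of two cliques (that is, $(n-1)$-regular graphs on $2n$ vertices) but are not isomorphic to $K_n\cup K_n$. A graph is 2-connected if it is connected and cannot be disconnected by removing a single vertex. A graph is Hamiltonian if it has a cycle visiting every vertex exactly once. *)

theory Defs
  imports "Graph_Theory.Graph_Theory" "HOL-Library.Multiset"
begin

text \<open>
  A finite simple graph is a \<^locale>\<open>graph\<close>, i.e. a finite, loop-free, symmetric digraph without
  parallel arcs. Each undirected edge is a pair of opposite arcs, so the degree of a vertex is its
  \<^const>\<open>out_degree\<close>, and \<^const>\<open>digraph_iso\<close> is the usual isomorphism of simple graphs.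
\<close>

definition degree_sequence :: "('a, 'b) pre_digraph \<Rightarrow> nat list" where
  "degree_sequence G =
     rev (sorted_list_of_multiset (image_mset (out_degree G) (mset_set (verts G))))"

definition clique :: "nat \<Rightarrow> nat pair_pre_digraph" where
  "clique n = \<lparr> pverts = {..<n}, parcs = {(i, j). i < n \<and> j < n \<and> i \<noteq> j} \<rparr>"

definition disjoint_union ::
  "'a pair_pre_digraph \<Rightarrow> 'c pair_pre_digraph \<Rightarrow> ('a + 'c) pair_pre_digraph" where
  "disjoint_union G H =
     \<lparr> pverts = pverts G <+> pverts H,
       parcs = map_prod Inl Inl ` parcs G \<union> map_prod Inr Inr ` parcs H \<rparr>"

definition two_cliques :: "nat \<Rightarrow> (nat + nat, (nat + nat) \<times> (nat + nat)) pre_digraph" where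
  "two_cliques n = with_proj (disjoint_union (clique n) (clique n))"

definition two_clique_class :: "nat \<Rightarrow> ('a, 'b) pre_digraph set" where
  "two_clique_class n =
     {G. graph G \<and> degree_sequence G = degree_sequence (two_cliques n) \<and>
         \<not> digraph_iso G (two_cliques n)}"

definition two_connected :: "('a, 'b) pre_digraph \<Rightarrow> bool" where
  "two_connected G \<longleftrightarrow>
     connected G \<and> (\<forall>v \<in> verts G. connected (pre_digraph.del_vert G v))"

text \<open>
  \<^const>\<open>pre_digraph.cycle\<close> already says that the heads of the arcs of \<open>p\<close> are pairwise distinct.
  The length bound excludes the closed walk along an edge and back, which is a cycle of a symmetric
  digraph but not of the undirected graph.
\<close>
definition hamiltonian :: "('a, 'b) pre_digraph \<Rightarrow> bool" where
  "hamiltonian G \<longleftrightarrow>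
     (\<exists>p. pre_digraph.cycle G p \<and> 3 \<le> length p \<and> set (map (head G) p) = verts G)"

lemma complete_digraph_clique: "complete_digraph n (with_proj (clique n))"
  unfolding complete_digraph_pair_def by (auto simp: clique_def)

lemma verts_two_cliques: "verts (two_cliques n) = {..<n} <+> {..<n}"
  by (simp add: two_cliques_def disjoint_union_def clique_def)

lemma out_degree_two_cliques:
  assumes "v \<in> verts (two_cliques n)"
  shows "out_degree (two_cliques n) v = n - 1"
proof -
  obtain i where i: "i < n" "v = Inl i \<or> v = Inr i"
    using assms by (auto simp: verts_two_cliques)
  have "out_arcs (two_cliques n) v =
      (if v = Inl i then (\<lambda>j. (Inl i, Inl j)) ` ({..<n} - {i})
       else (\<lambda>j. (Inr i, Inr j)) ` ({..<n} - {i}))"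
    using i by (auto simp: out_arcs_def two_cliques_def disjoint_union_def clique_def
        image_iff)
  then show ?thesis
    using i(1) by (auto simp: out_degree_def card_image inj_on_def)
qed

lemma two_clique_class_iff:
  "G \<in> two_clique_class n \<longleftrightarrow>
     graph G \<and> card (verts G) = 2 * n \<and> (\<forall>v \<in> verts G. out_degree G v = n - 1) \<and>
     \<not> digraph_iso G (two_cliques n)"
proof -
  have K: "image_mset (out_degree (two_cliques n)) (mset_set (verts (two_cliques n)))
      = replicate_mset (2 * n) (n - 1)"
  proof -
    have "image_mset (out_degree (two_cliques n)) (mset_set (verts (two_cliques n)))
      = image_mset (\<lambda>_. n - 1) (mset_set (verts (two_cliques n)))"
      by (rule image_mset_cong) (auto simp: out_degree_two_cliques verts_two_cliques)
    also have "\<dots> = replicate_mset (card (verts (two_cliques n))) (n - 1)"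
      by (simp add: image_mset_const_eq)
    finally show ?thesis by (simp add: verts_two_cliques card_Plus mult_2)
  qed
  have "degree_sequence G = degree_sequence (two_cliques n) \<longleftrightarrow>
      card (verts G) = 2 * n \<and> (\<forall>v \<in> verts G. out_degree G v = n - 1)" if "graph G"
  proof -
    interpret graph G by fact
    have "degree_sequence G = degree_sequence (two_cliques n) \<longleftrightarrow>
      image_mset (out_degree G) (mset_set (verts G)) = replicate_mset (2 * n) (n - 1)"
      unfolding degree_sequence_def K
      by (metis mset_sorted_list_of_multiset rev_rev_ident)
    also have "\<dots> \<longleftrightarrow> card (verts G) = 2 * n \<and> (\<forall>v \<in> verts G. out_degree G v = n - 1)"
    proof
      assume A: "image_mset (out_degree G) (mset_set (verts G)) = replicate_mset (2 * n) (n - 1)"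
      then have "size (mset_set (verts G)) = 2 * n"
        by (metis size_image_mset size_replicate_mset)
      moreover have "out_degree G v = n - 1" if "v \<in> verts G" for v
      proof -
        have "out_degree G v \<in># image_mset (out_degree G) (mset_set (verts G))"
          using that by simp
        then show ?thesis unfolding A by (simp split: if_splits)
      qed
      ultimately show "card (verts G) = 2 * n \<and> (\<forall>v \<in> verts G. out_degree G v = n - 1)"
        by simp
    next
      assume A: "card (verts G) = 2 * n \<and> (\<forall>v \<in> verts G. out_degree G v = n - 1)"
      then have "image_mset (out_degree G) (mset_set (verts G))
          = image_mset (\<lambda>_. n - 1) (mset_set (verts G))"
        by (intro image_mset_cong) auto
      then show "image_mset (out_degree G) (mset_set (verts G)) = replicate_mset (2 * n) (n - 1)"
        using A by (simp add: image_mset_const_eq)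
    qed
    finally show ?thesis .
  qed
  then show ?thesis by (auto simp: two_clique_class_def)
qed

end

theory Submission
  imports Defs
begin

text \<open>
  Write \<open>k = n - 1\<close>, so that \<open>G\<close> is \<open>k\<close>-regular on \<open>2 * k + 2\<close> vertices. A set of vertices
  without outgoing edges has at least \<open>k + 1\<close> elements, and so has its complement. Hence in a
  disconnected graph both have exactly \<open>k + 1\<close> elements and induce complete graphs, which makes
  the graph two cliques. If only the edges to a single vertex \<open>v\<close> leave a set, the set has at least
  \<open>k\<close> elements, and if it has exactly \<open>k\<close>, then adding \<open>v\<close> gives a set without outgoing edges;
  as the \<open>2 * k + 1\<close> vertices other than \<open>v\<close> cannot be split into two parts of more than \<open>k\<close>
  elements each, there is no cut vertex.

  A Hamiltonian cycle is found in two stages. The first is that a cycle through at least \<open>2 * k\<close>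
  vertices yields a Hamiltonian one (\<open>long_cycle_imp_hamiltonian_cycle\<close>). Suppose that there is no
  Hamiltonian cycle. If a cycle misses a single vertex \<open>x\<close>, then \<open>x\<close> and the successors of its
  neighbours on the cycle form an independent set of \<open>k + 1\<close> vertices. The edges leaving that set
  already use up all degrees in its complement, so the complement is independent as well, although it
  contains two consecutive vertices of the cycle. If a cycle misses two non-adjacent vertices, the same
  counting determines the graph so far that a Hamiltonian cycle can be written down. If the two missed
  vertices are adjacent, their neighbours must lie so far apart on the cycle that \<open>k \<le> 3\<close> and that
  they have a common neighbour on the cycle; but that neighbour has degree at least 4.

  The second stage finds a cycle through at least \<open>2 * k\<close> vertices (\<open>ex_long_cycle\<close>). All
  neighbours of the two ends of a longest path lie on the path. Were a neighbour of the last vertex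
  placed before a neighbour of the first one, then a closest such pair would close a long cycle, since
  at most one position of the path is not accounted for by the two degrees. So all neighbours of the
  first vertex come before all neighbours of the last vertex, except that one vertex may be both.
  As there is no cut vertex, edges bridge over the place where the two neighbourhoods meet, and one or
  two such edges, together with edges at the two ends, again close a long cycle.
\<close>

section \<open>Segments of a list\<close>

definition slice :: "'a list \<Rightarrow> nat \<Rightarrow> nat \<Rightarrow> 'a list" where
  "slice xs a b = drop a (take b xs)"

lemma slice_append: "a \<le> b \<Longrightarrow> b \<le> c \<Longrightarrow> slice xs a b @ slice xs b c = slice xs a c"
proof -
  assume le: "a \<le> b" "b \<le> c"
  define ys where "ys = take c xs"
  have "take b xs = take b ys" using le by (simp add: ys_def min_def)
  moreover have "drop a ys = drop a (take b ys @ drop b ys)" by simp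
  moreover have "drop a (take b ys @ drop b ys) = drop a (take b ys) @ drop b ys"
    using le by (cases "b \<le> length ys") (simp_all only: drop_append, simp_all)
  ultimately show ?thesis by (simp add: slice_def ys_def)
qed

lemma slice_full: "slice xs 0 (length xs) = xs"
  by (simp add: slice_def)

lemma length_slice: "b \<le> length xs \<Longrightarrow> length (slice xs a b) = b - a"
  by (simp add: slice_def)

lemma slice_eq_Nil: "b \<le> length xs \<Longrightarrow> slice xs a b = [] \<longleftrightarrow> b \<le> a"
  by (auto simp: slice_def)

lemma hd_slice: "a < b \<Longrightarrow> b \<le> length xs \<Longrightarrow> hd (slice xs a b) = xs ! a"
  by (simp add: slice_def hd_drop_conv_nth)

lemma last_slice: "a < b \<Longrightarrow> b \<le> length xs \<Longrightarrow> last (slice xs a b) = xs ! (b - 1)"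
  by (cases "xs = []") (simp_all add: slice_def last_conv_nth)

section \<open>Connectivity\<close>

text \<open>
  The condition \<open>no_split\<close> is how being different from two cliques is used: a set of \<open>k + 1\<close>
  vertices without outgoing edges and its complement are both cliques by regularity.
\<close>
locale half_regular =
  fixes V :: "'a set" and adj :: "'a \<Rightarrow> 'a \<Rightarrow> bool" and k :: nat
  assumes finite_V: "finite V"
    and adj_sym: "adj u v \<Longrightarrow> adj v u"
    and adj_irrefl: "\<not> adj u u"
    and adj_in: "adj u v \<Longrightarrow> v \<in> V"
    and degree: "v \<in> V \<Longrightarrow> card {w. adj v w} = k"
    and order: "card V = 2 * k + 2"
    and no_split: "\<lbrakk>S \<subseteq> V; card S = k + 1\<rbrakk> \<Longrightarrow> \<exists>u\<in>S. \<exists>w\<in>V - S. adj u w"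
begin

abbreviation nb :: "'a \<Rightarrow> 'a set" where "nb v \<equiv> {w. adj v w}"

lemma nb_subset: "nb v \<subseteq> V"
  using adj_in by blast

lemma finite_nb: "finite (nb v)"
  using nb_subset finite_V finite_subset by blast

text \<open>
  A vertex of a set without outgoing edges has all its \<open>k\<close> neighbours in the set. So such a set and
  its complement would both have at least, and hence exactly, \<open>k + 1\<close> elements.
\<close>
lemma edge_leaving:
  assumes "S \<subseteq> V" "S \<noteq> {}" "S \<noteq> V"
  shows "\<exists>u\<in>S. \<exists>w\<in>V - S. adj u w"
proof (rule ccontr)
  assume neg: "\<not> ?thesis"
  have big: "k + 1 \<le> card T" if T: "T \<subseteq> V" "T \<noteq> {}" "\<And>u w. u \<in> T \<Longrightarrow> adj u w \<Longrightarrow> w \<in> T" for T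
  proof -
    obtain v where v: "v \<in> T" using T by blast
    have "insert v (nb v) \<subseteq> T" using T v by blast
    then have "card (insert v (nb v)) \<le> card T"
      using T finite_V by (meson card_mono finite_subset)
    moreover have "card (insert v (nb v)) = k + 1"
      using finite_nb adj_irrefl degree T v by auto
    ultimately show ?thesis by simp
  qed
  have "k + 1 \<le> card S" using assms neg adj_in by (intro big) blast+
  moreover have "k + 1 \<le> card (V - S)"
    using assms neg adj_in adj_sym by (intro big) blast+
  moreover have "card S + card (V - S) = 2 * k + 2"
    using assms order finite_V by (metis card_Diff_subset card_mono finite_subset le_add_diff_inverse)
  ultimately have "card S = k + 1" by simp
  then show False using no_split neg assms by blast
qed

text \<open>
  Otherwise the vertices other than \<open>v\<close> fall into two nonempty parts whose edges stay inside or lead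
  to \<open>v\<close>. A part \<open>T\<close> with at most \<open>k\<close> elements would have exactly \<open>k\<close> elements, all adjacent to \<open>v\<close>,
  so \<open>v\<close> would have no further neighbours and \<open>insert v T\<close> would contradict \<open>no_split\<close>. But two parts
  with more than \<open>k\<close> elements do not fit into \<open>2 * k + 1\<close> vertices.
\<close>
lemma edge_leaving_avoiding_vertex:
  assumes v: "v \<in> V" and "S \<subseteq> V - {v}" "S \<noteq> {}" "S \<noteq> V - {v}"
  shows "\<exists>u\<in>S. \<exists>w\<in>V - {v} - S. adj u w"
proof (rule ccontr)
  assume neg: "\<not> ?thesis"
  have large: "k + 1 \<le> card T"
    if T: "T \<subseteq> V - {v}" "T \<noteq> {}" "\<And>u w. u \<in> T \<Longrightarrow> adj u w \<Longrightarrow> w \<in> insert v T" for T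
  proof (rule ccontr)
    assume "\<not> ?thesis"
    then have le: "card T \<le> k" by simp
    have vT: "v \<notin> T" using T(1) by blast
    have fT: "finite T" using T finite_V by (meson finite_Diff finite_subset)
    have full: "nb u = insert v T - {u}" if u: "u \<in> T" for u
    proof (rule card_subset_eq)
      show "finite (insert v T - {u})" using fT by simp
      show sub: "nb u \<subseteq> insert v T - {u}" using T u adj_irrefl by blast
      have "card (insert v T - {u}) = card T" using fT vT u by simp
      moreover have "card (nb u) = k" using degree T u by blast
      ultimately show "card (nb u) = card (insert v T - {u})"
        using le card_mono[OF _ sub] fT by simp
    qed
    obtain u where u: "u \<in> T" using T by blast
    have kT: "card T = k"
    proof -
      have "card (insert v T - {u}) = card T" using fT vT u by simp
      then show ?thesis using full[OF u] degree[of u] T(1) u by auto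
    qed
    have "T \<subseteq> nb v"
    proof
      fix u assume "u \<in> T"
      then have "v \<in> nb u" using full vT by auto
      then show "u \<in> nb v" using adj_sym by simp
    qed
    then have nbv: "nb v = T"
      using degree[OF v] kT finite_nb by (metis card_subset_eq)
    have "card (insert v T) = k + 1" using kT fT vT by simp
    moreover have "insert v T \<subseteq> V" using T v by blast
    ultimately have "\<exists>u\<in>insert v T. \<exists>w\<in>V - insert v T. adj u w" using no_split by blast
    then show False using nbv T by blast
  qed
  have "k + 1 \<le> card S" using assms neg adj_in by (intro large) blast+
  moreover have "k + 1 \<le> card (V - {v} - S)"
    using assms neg adj_in adj_sym by (intro large) blast+
  moreover have "card S + card (V - {v} - S) = 2 * k + 1"
  proof -
    have "card (V - {v}) = 2 * k + 1" using order v by simp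
    moreover have "finite (V - {v})" using finite_V by simp
    ultimately show ?thesis
      using assms(2) card_Diff_subset[of S "V - {v}"] card_mono[of "V - {v}" S]
        finite_subset[of S "V - {v}"] by linarith
  qed
  ultimately show False by simp
qed

text \<open>
  Connectivity gives an edge between some \<open>v\<close> and \<open>u\<close>, and since \<open>v\<close> is not a cut vertex, \<open>u\<close> has a
  second neighbour.
\<close>
lemma degree_ge_2: "2 \<le> k"
proof -
  have "V \<noteq> {}" using order by auto
  then obtain v where v: "v \<in> V" by blast
  have "{v} \<noteq> V" using order by (auto dest: arg_cong[of _ _ card])
  then obtain u where u: "u \<in> V" "adj v u" using edge_leaving[of "{v}"] v by blast
  have vu: "v \<noteq> u" using u adj_irrefl by blast
  have "V - {v} \<noteq> {u}"
  proof
    assume "V - {v} = {u}"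
    then have "V = {u, v}" using u v by blast
    then have "card V = 2" using vu by auto
    then have "k = 0" using order by simp
    then show False using degree[OF v] u finite_nb by auto
  qed
  then obtain w where w: "w \<in> V" "w \<noteq> v" "adj u w"
    using edge_leaving_avoiding_vertex[of v "{u}"] u v vu by blast
  have "{v, w} \<subseteq> nb u" using u w adj_sym by blast
  then have "card {v, w} \<le> card (nb u)" using finite_nb card_mono by blast
  then show ?thesis using degree u w by simp
qed

section \<open>Paths and cycles as vertex lists\<close>

definition path :: "'a list \<Rightarrow> bool" where
  "path xs \<longleftrightarrow> distinct xs \<and> set xs \<subseteq> V \<and> successively adj xs"

text \<open>
  The list holds every vertex of the cycle once, so the closing edge runs from the last entry to the
  first one. The length bound excludes a single edge, traversed back and forth.
\<close>
definition cycle :: "'a list \<Rightarrow> bool" where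
  "cycle xs \<longleftrightarrow> path xs \<and> 3 \<le> length xs \<and> adj (last xs) (hd xs)"

lemma path_append:
  "path (xs @ ys) \<longleftrightarrow> path xs \<and> path ys \<and> set xs \<inter> set ys = {} \<and>
     (xs \<noteq> [] \<longrightarrow> ys \<noteq> [] \<longrightarrow> adj (last xs) (hd ys))"
  by (auto simp: path_def successively_append_iff)

lemma path_Cons:
  "path (x # xs) \<longleftrightarrow> x \<in> V \<and> path xs \<and> x \<notin> set xs \<and> (xs \<noteq> [] \<longrightarrow> adj x (hd xs))"
  by (auto simp: path_def successively_Cons)

lemma path_rev [simp]: "path (rev xs) \<longleftrightarrow> path xs"
proof -
  have swap: "(\<lambda>x y. adj y x) = adj" using adj_sym by blast
  have "successively (\<lambda>x y. adj y x) xs = successively adj xs"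
    by (rule arg_cong[OF swap, of "\<lambda>r. successively r xs"])
  then show ?thesis by (simp add: path_def)
qed

lemma path_Nil [simp]: "path []"
  by (simp add: path_def)

lemma cycle_rotate: "cycle xs \<Longrightarrow> cycle (rotate n xs)"
proof (induction n)
  case (Suc n)
  have "cycle (rotate1 ys)" if "cycle ys" for ys
    using that by (cases ys) (auto simp: cycle_def path_append path_Cons hd_append)
  then show ?case using Suc by simp
qed simp

lemma path_length_le: "path xs \<Longrightarrow> length xs \<le> 2 * k + 2"
  using order finite_V card_mono[of V "set xs"] distinct_card[of xs] by (auto simp: path_def)

text \<open>
  The three lemmas below reconnect a path to a cycle. In each of them the path is cut into segments,
  some of which are dropped (\<open>gs\<close>, \<open>hs\<close>) and some reversed. Here each end of the path is joined to a
  vertex beyond the dropped segment.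
\<close>
lemma cycle_from_crossing_chords:
  assumes "path (as @ gs @ bs)" "as \<noteq> []" "bs \<noteq> []" "3 \<le> length as + length bs"
    and "adj (hd as) (hd bs)" "adj (last bs) (last as)"
  shows "cycle (rev as @ bs)"
  using assms by (auto simp: cycle_def path_append hd_rev last_rev hd_append last_append)

text \<open>
  Here each end of the path is joined only to a vertex of the middle segment, and an edge bridging
  that segment closes the cycle.
\<close>
lemma cycle_from_end_chords_and_bridge:
  assumes "path (as @ gs @ bs @ hs @ cs)" "as \<noteq> []" "bs \<noteq> []" "cs \<noteq> []"
    and "adj (hd cs) (last as)" "adj (hd as) (hd bs)" "adj (last bs) (last cs)"
  shows "cycle (rev as @ bs @ rev cs)"
proof -
  have "3 \<le> length (rev as @ bs @ rev cs)"
    using assms(2-4) by (cases as; cases bs; cases cs) auto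
  then show ?thesis
    using assms
    by (auto simp: cycle_def path_append hd_rev last_rev hd_append last_append)
qed

text \<open>
  The edges from the end of \<open>as\<close> to the start of \<open>cs\<close> and from the end of \<open>bs\<close> to the start of \<open>ds\<close>
  replace the path edges between consecutive segments; the ends of the path reach only their
  own side, and no vertex is lost.
\<close>
lemma cycle_from_two_bridges:
  assumes "path (as @ bs @ cs @ ds)" "as \<noteq> []" "bs \<noteq> []" "cs \<noteq> []" "ds \<noteq> []"
    and "adj (hd as) (hd bs)" "adj (last bs) (hd ds)" "adj (last ds) (last cs)" "adj (hd cs) (last as)"
  shows "cycle (rev as @ bs @ ds @ rev cs)"
proof -
  have "3 \<le> length (rev as @ bs @ ds @ rev cs)"
    using assms(2-4) by (cases as; cases bs; cases cs) auto
  then show ?thesis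
    using assms
    by (auto simp: cycle_def path_append hd_rev last_rev hd_append last_append)
qed

section \<open>Cycles missing one or two vertices\<close>

text \<open>
  The cycle \<open>cs\<close> written as a list that starts at the successor of \<open>c\<close> and ends in \<open>c\<close>. Arguments
  on cycles then need no index arithmetic: a new vertex goes between the two ends of the list, and any
  other place of interest splits the list in two.
\<close>
definition opened :: "'a list \<Rightarrow> ('a \<Rightarrow> 'a) \<Rightarrow> 'a \<Rightarrow> 'a list \<Rightarrow> bool" where
  "opened cs s c ds \<longleftrightarrow> cycle ds \<and> set ds = set cs \<and> hd ds = s c \<and> last ds = c \<and>
     (\<forall>as bs. ds = as @ bs \<longrightarrow> as \<noteq> [] \<longrightarrow> bs \<noteq> [] \<longrightarrow> hd bs = s (last as))"

definition successor :: "'a list \<Rightarrow> ('a \<Rightarrow> 'a) \<Rightarrow> bool" where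
  "successor cs s \<longleftrightarrow> bij_betw s (set cs) (set cs) \<and> (\<forall>c\<in>set cs. \<exists>ds. opened cs s c ds)"

lemma ex_successor:
  assumes cyc: "cycle cs"
  shows "\<exists>s. successor cs s"
proof -
  define L where "L = length cs"
  have L: "3 \<le> L" and dist: "distinct cs" using cyc by (auto simp: cycle_def path_def L_def)
  define idx where "idx = the_inv_into {..<L} ((!) cs)"
  have inj: "inj_on ((!) cs) {..<L}" using dist by (auto simp: inj_on_nth L_def)
  have idx: "idx (cs ! i) = i" if "i < L" for i
    unfolding idx_def using the_inv_into_f_f[OF inj] that by simp
  define s where "s c = cs ! (Suc (idx c) mod L)" for c
  have s_nth: "s (cs ! i) = cs ! (Suc i mod L)" if "i < L" for i
    using idx that by (simp add: s_def)
  have rot: "rotate m cs ! i = cs ! ((m + i) mod L)" if "i < L" for m i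
    using that by (simp add: nth_rotate L_def)
  have main: "\<exists>ds. opened cs s c ds" if c: "c \<in> set cs" for c
  proof -
    obtain i where i: "i < L" "c = cs ! i" using c by (auto simp: in_set_conv_nth L_def)
    define ds where "ds = rotate (Suc i) cs"
    have len: "length ds = L" by (simp add: ds_def L_def)
    then have ne: "ds \<noteq> []" using L by auto
    have d: "ds ! j = cs ! ((Suc i + j) mod L)" if "j < L" for j
      unfolding ds_def using rot that by blast
    have "hd ds = s c" using d[of 0] L ne i s_nth by (simp add: hd_conv_nth)
    moreover have "last ds = c"
      using d[of "L - 1"] L ne i len by (simp add: last_conv_nth)
    moreover have "hd bs = s (last as)" if ab: "ds = as @ bs" "as \<noteq> []" "bs \<noteq> []" for as bs
    proof -
      define j where "j = length as - 1"
      have j: "Suc j < L" "length as = Suc j" using ab len by (auto simp: j_def)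
      have "last as = ds ! j" using ab j by (simp add: last_conv_nth nth_append)
      moreover have "hd bs = ds ! Suc j" using ab j by (simp add: hd_conv_nth nth_append)
      moreover have "s (cs ! ((Suc i + j) mod L)) = cs ! ((Suc i + Suc j) mod L)"
        using L by (subst s_nth) (auto simp: mod_Suc_eq)
      ultimately show ?thesis using d j by simp
    qed
    moreover have "cycle ds" unfolding ds_def using cyc cycle_rotate by blast
    ultimately show ?thesis unfolding opened_def by (intro exI[of _ ds]) (auto simp: ds_def)
  qed
  have surj: "s ` set cs = set cs"
  proof
    show "s ` set cs \<subseteq> set cs"
    proof
      fix y assume "y \<in> s ` set cs"
      then obtain c where c: "c \<in> set cs" "y = s c" by blast
      obtain ds where ds: "cycle ds" "set ds = set cs" "hd ds = s c"
        using main[OF c(1)] unfolding opened_def by blast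
      then have "ds \<noteq> []" by (auto simp: cycle_def)
      then show "y \<in> set cs" using ds c by (metis hd_in_set)
    qed
    show "set cs \<subseteq> s ` set cs"
    proof
      fix y assume "y \<in> set cs"
      then obtain i where i: "i < L" "y = cs ! i" by (auto simp: in_set_conv_nth L_def)
      have "s (cs ! ((i + (L - 1)) mod L)) = cs ! (Suc (i + (L - 1)) mod L)"
        using L by (subst s_nth) (auto simp: mod_Suc_eq)
      also have "Suc (i + (L - 1)) mod L = i" using L i by simp
      finally have "y = s (cs ! ((i + (L - 1)) mod L))" using i by simp
      moreover have "cs ! ((i + (L - 1)) mod L) \<in> set cs"
        using L by (metis L_def mod_less_divisor nth_mem not_numeral_le_zero zero_less_iff_neq_zero)
      ultimately show "y \<in> s ` set cs" by blast
    qed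
  qed
  then have "bij_betw s (set cs) (set cs)"
    by (simp add: bij_betw_def eq_card_imp_inj_on)
  then show ?thesis unfolding successor_def using main by blast
qed

lemma successor_in: "successor cs s \<Longrightarrow> c \<in> set cs \<Longrightarrow> s c \<in> set cs"
  by (auto simp: successor_def bij_betw_def)

lemma successor_inj: "successor cs s \<Longrightarrow> inj_on s (set cs)"
  by (auto simp: successor_def bij_betw_def)

lemma successor_surj: "successor cs s \<Longrightarrow> s ` set cs = set cs"
  by (auto simp: successor_def bij_betw_def)

lemma opened_decomp:
  assumes "opened cs s c ds"
  obtains e es where "ds = s c # s (s c) # e # es" "last (e # es) = c"
proof -
  obtain a b e es where e: "ds = a # b # e # es"
    using assms by (auto simp: opened_def cycle_def numeral_3_eq_3 Suc_le_length_iff)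
  have "a = s c" "last (e # es) = c" using assms e by (auto simp: opened_def)
  moreover have "b = s a"
    using assms e unfolding opened_def by (metis append_Cons append_Nil last.simps list.distinct(1) list.sel(1))
  ultimately show ?thesis using that e by blast
qed

lemma successor_adj: "successor cs s \<Longrightarrow> c \<in> set cs \<Longrightarrow> adj c (s c)"
  unfolding successor_def opened_def cycle_def by metis

lemma successor_twice_neq:
  assumes "successor cs s" "c \<in> set cs"
  shows "s (s c) \<noteq> c"
proof -
  obtain ds where ds: "opened cs s c ds" using assms by (auto simp: successor_def)
  obtain e es where e: "ds = s c # s (s c) # e # es" "last (e # es) = c"
    using opened_decomp[OF ds] by blast
  have "distinct ds" using ds by (auto simp: opened_def cycle_def path_def)
  then show ?thesis using e by (metis distinct.simps(2) last_in_set list.distinct(1))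
qed

lemma cycle_insert:
  assumes s: "successor cs s" and "c \<in> set cs" "x \<in> V" "x \<notin> set cs" "adj x c" "adj x (s c)"
  shows "\<exists>ds. cycle ds \<and> set ds = insert x (set cs)"
proof -
  obtain ds where ds: "opened cs s c ds" using assms by (auto simp: successor_def)
  then have "ds \<noteq> []" by (auto simp: opened_def cycle_def)
  then have "cycle (x # ds) \<and> set (x # ds) = insert x (set cs)"
    using ds assms adj_sym by (auto simp: opened_def cycle_def path_Cons)
  then show ?thesis by blast
qed

text \<open>
  Open the cycle at \<open>c\<close> and reverse the segment that starts at \<open>s c\<close> and ends in \<open>d\<close>. The edge between
  \<open>s c\<close> and \<open>s d\<close> joins it to the rest, and \<open>x\<close> closes the cycle between \<open>c\<close> and \<open>d\<close>.
\<close>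
lemma cycle_insert_exchange:
  assumes s: "successor cs s" and "c \<in> set cs" "d \<in> set cs" "c \<noteq> d" "x \<in> V" "x \<notin> set cs"
    and "adj x c" "adj x d" "adj (s c) (s d)"
  shows "\<exists>ds. cycle ds \<and> set ds = insert x (set cs)"
proof -
  obtain ds where ds: "opened cs s c ds" using assms by (auto simp: successor_def)
  have "d \<in> set ds" using ds assms by (auto simp: opened_def)
  then obtain as bs where "ds = as @ d # bs" by (meson split_list)
  then have ab: "ds = (as @ [d]) @ bs" by simp
  have bs: "bs \<noteq> []" using ab ds assms by (auto simp: opened_def)
  define as' where "as' = as @ [d]"
  have as': "ds = as' @ bs" "as' \<noteq> []" "last as' = d" using ab by (auto simp: as'_def)
  have "hd bs = s d" using ds as' bs unfolding opened_def by metis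
  moreover have "hd as' = s c" "last bs = c" using ds as' bs by (auto simp: opened_def)
  ultimately have "cycle (x # rev as' @ bs) \<and> set (x # rev as' @ bs) = insert x (set cs)"
    using ds assms adj_sym as' bs
    by (auto simp: opened_def cycle_def path_Cons path_append hd_append hd_rev last_rev)
  then show ?thesis by blast
qed

lemma successors_of_neighbours_independent:
  assumes s: "successor cs s" and C: "set cs \<subseteq> V" and x: "x \<in> V" "x \<notin> set cs"
    and max: "\<nexists>ds. cycle ds \<and> set ds = insert x (set cs)"
    and uv: "u \<in> insert x (s ` (nb x \<inter> set cs))" "v \<in> insert x (s ` (nb x \<inter> set cs))"
  shows "\<not> adj u v"
proof
  assume uv_adj: "adj u v"
  have xs: "\<not> adj x (s c)" if "c \<in> nb x \<inter> set cs" for c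
    using cycle_insert[OF s _ x] max that by blast
  have "u \<noteq> x" using uv(2) uv_adj xs adj_irrefl[of x] by auto
  moreover have "v \<noteq> x" using uv(1) adj_sym[OF uv_adj] xs adj_irrefl[of x] by auto
  ultimately obtain c d where c: "c \<in> nb x \<inter> set cs" "u = s c" and d: "d \<in> nb x \<inter> set cs" "v = s d"
    using uv by blast
  have "c \<noteq> d" using c d uv_adj adj_irrefl by blast
  then show False using cycle_insert_exchange[OF s _ _ _ x] max c d uv_adj by blast
qed

text \<open>
  The \<open>k * (k + 1)\<close> edges at the independent half all lead to the other half, where they exhaust the
  sum of the degrees.
\<close>
lemma complement_of_half_independent:
  assumes S: "S \<subseteq> V" "card S = k + 1" and ind: "\<And>u v. \<lbrakk>u \<in> S; v \<in> S\<rbrakk> \<Longrightarrow> \<not> adj u v"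
    and ab: "a \<in> V - S" "b \<in> V - S"
  shows "\<not> adj a b"
proof
  assume adj: "adj a b"
  let ?T = "V - S"
  have fin: "finite S" "finite ?T" using S finite_V finite_subset by auto
  have cT: "card ?T = k + 1" using S order fin by (simp add: card_Diff_subset)
  have "{t \<in> ?T. adj t u} = nb u" if "u \<in> S" for u
    using ind[OF that] nb_subset adj_sym by blast
  then have "\<forall>u\<in>S. card {t \<in> ?T. adj t u} = k" using degree S by auto
  then have sum: "(\<Sum>t\<in>?T. card {u \<in> S. adj t u}) = k * card S"
    using sum_multicount[OF fin(2,1)] by blast
  have le: "card {u \<in> S. adj t u} \<le> k" if "t \<in> ?T" for t
    using degree[of t] that finite_nb card_mono[of "nb t" "{u \<in> S. adj t u}"] by auto
  have "{u \<in> S. adj a u} \<subset> nb a" using adj ab by blast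
  then have "card {u \<in> S. adj a u} < k" using degree[of a] ab finite_nb psubset_card_mono by blast
  then have "(\<Sum>t\<in>?T. card {u \<in> S. adj t u}) < (\<Sum>t\<in>?T. k)"
    using le ab fin by (intro sum_strict_mono_ex1) auto
  then show False using sum cT S by simp
qed

text \<open>
  The set \<open>?S\<close> of \<open>x\<close> and the successors of its neighbours is independent and contains half of all
  vertices. Its complement consists of the neighbours of \<open>x\<close> and one more vertex \<open>t\<close>; both \<open>t\<close> and its
  successor lie in the complement, which contradicts its independence.
\<close>
lemma no_cycle_missing_one:
  assumes nonham: "\<nexists>ds. cycle ds \<and> set ds = V" and cyc: "cycle cs"
  shows "card (set cs) \<noteq> 2 * k + 1"
proof
  assume card: "card (set cs) = 2 * k + 1"
  have C: "set cs \<subseteq> V" using cyc by (simp add: cycle_def path_def)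
  have "card (V - set cs) = 1" using card order C by (simp add: card_Diff_subset)
  then obtain x where "V - set cs = {x}" using card_1_singletonE by blast
  then have x: "x \<in> V" "x \<notin> set cs" "V = insert x (set cs)" using C by auto
  obtain s where s: "successor cs s" using ex_successor[OF cyc] by blast
  let ?X = "nb x" let ?S = "insert x (s ` ?X)"
  have X: "?X \<subseteq> set cs" using nb_subset[of x] x adj_irrefl by auto
  have X': "?X \<inter> set cs = ?X" using X by blast
  have ind: "\<not> adj u v" if "u \<in> ?S" "v \<in> ?S" for u v
    using successors_of_neighbours_independent[OF s C x(1,2)] nonham x(3) that X' by metis
  have sX: "s ` ?X \<subseteq> set cs" using X successor_in[OF s] by blast
  have "card (s ` ?X) = k"
    using X successor_inj[OF s] degree[OF x(1)] card_image inj_on_subset by metis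
  moreover have "x \<notin> s ` ?X" using sX x by blast
  ultimately have cS: "card ?S = k + 1" using finite_nb by simp
  have S: "?S \<subseteq> V" using sX x by blast
  have T: "\<not> adj a b" if "a \<in> V - ?S" "b \<in> V - ?S" for a b
    using complement_of_half_independent[OF S cS ind] that by blast
  have "card (V - ?S) = k + 1" using S cS order finite_V
    by (simp add: card_Diff_subset finite_nb)
  then have "\<not> V - ?S \<subseteq> ?X" using degree[OF x(1)] finite_nb card_mono
    by (metis Suc_eq_plus1 Suc_n_not_le_n)
  then obtain t where t: "t \<in> V - ?S" "t \<notin> ?X" by blast
  have tC: "t \<in> set cs" using t x by blast
  have "s t \<notin> s ` ?X" using t X tC successor_inj[OF s] by (simp add: inj_on_image_mem_iff)
  then have "s t \<in> V - ?S" using successor_in[OF s tC] C x by blast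
  then show False using T t successor_adj[OF s tC] by blast
qed

text \<open>
  The neighbours of \<open>x\<close> occupy every other place of the cycle, and by
  \<open>complement_of_half_independent\<close> those of \<open>y\<close> are the remaining places. For consecutive vertices
  \<open>b, a, s a, e\<close> of the cycle with \<open>a\<close> and \<open>e\<close> adjacent to \<open>x\<close>, the detour \<open>b, y, s a, a, x, e\<close> then
  takes in both missed vertices.
\<close>
lemma no_cycle_missing_nonadjacent_pair:
  assumes nonham: "\<nexists>ds. cycle ds \<and> set ds = V" and cyc: "cycle cs"
    and V: "V = insert x (insert y (set cs))" and xy: "x \<noteq> y" "x \<notin> set cs" "y \<notin> set cs"
    and nadj: "\<not> adj x y"
  shows False
proof -
  have C: "set cs \<subseteq> V" and x: "x \<in> V" and y: "y \<in> V" using V by auto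
  have cC: "card (set cs) = 2 * k" using order V xy by simp
  obtain s where s: "successor cs s" using ex_successor[OF cyc] by blast
  let ?X = "nb x" let ?S = "insert x (s ` ?X)"
  have X: "?X \<subseteq> set cs" using nb_subset[of x] V adj_irrefl nadj by auto
  have X': "?X \<inter> set cs = ?X" using X by blast
  have max: "\<nexists>ds. cycle ds \<and> set ds = insert x (set cs)"
  proof
    assume "\<exists>ds. cycle ds \<and> set ds = insert x (set cs)"
    then obtain ds where "cycle ds" "set ds = insert x (set cs)" by blast
    moreover from this have "card (set ds) = 2 * k + 1" using cC xy by simp
    ultimately show False using no_cycle_missing_one[OF nonham] by blast
  qed
  have ind: "\<not> adj u v" if "u \<in> ?S" "v \<in> ?S" for u v
    using successors_of_neighbours_independent[OF s C x xy(2) max] that X' by metis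
  have sX: "s ` ?X \<subseteq> set cs" using X successor_in[OF s] by blast
  have csX: "card (s ` ?X) = k"
    using X successor_inj[OF s] degree[OF x(1)] card_image inj_on_subset by metis
  have disj: "?X \<inter> s ` ?X = {}" using ind by blast
  have "card (?X \<union> s ` ?X) = 2 * k" using csX degree[OF x] disj finite_nb
    by (subst card_Un_disjoint) auto
  then have split: "?X \<union> s ` ?X = set cs"
    using cC X sX by (intro card_subset_eq) auto
  have "x \<notin> s ` ?X" using sX xy by blast
  then have cS: "card ?S = k + 1" using csX finite_nb by simp
  have S: "?S \<subseteq> V" using sX x C by blast
  have T: "\<not> adj a b" if "a \<in> V - ?S" "b \<in> V - ?S" for a b
    using complement_of_half_independent[OF S cS ind] that by blast
  have "nb y \<subseteq> s ` ?X"
  proof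
    fix w assume w: "w \<in> nb y"
    have "y \<in> V - ?S" using y xy sX by blast
    then have "w \<in> ?S" using T w adj_in by blast
    then show "w \<in> s ` ?X" using w nadj adj_sym by blast
  qed
  then have Y: "nb y = s ` ?X" using csX degree[OF y] finite_nb
    by (intro card_subset_eq) auto
  \<comment> \<open>\<open>b\<close> is the predecessor of a neighbour \<open>a\<close> of \<open>x\<close>, and hence adjacent to \<open>y\<close>.\<close>
  obtain a where a: "a \<in> ?X" using degree[OF x] degree_ge_2
    by (metis all_not_in_conv card.empty not_numeral_le_zero)
  have aC: "a \<in> s ` set cs" using a X successor_surj[OF s] by blast
  then obtain b where b: "b \<in> set cs" "a = s b" by blast
  have "b \<notin> ?X" using a b disj by blast
  then have bY: "b \<in> nb y" using b split Y by blast
  obtain ds where ds: "opened cs s b ds" using s b by (auto simp: successor_def)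
  obtain e es where e: "ds = a # s a # e # es" "last (e # es) = b"
    using opened_decomp[OF ds] b by metis
  have "length ds = 2 * k"
    using ds cC distinct_card[of ds] by (auto simp: opened_def cycle_def path_def)
  \<comment> \<open>The cycle has an even number, at least 4, of vertices, so that \<open>b\<close> differs from \<open>e\<close>.\<close>
  moreover have "length ds = 3" if "es = []" using e(1) that by simp
  ultimately have es: "es \<noteq> []" using degree_ge_2 by fastforce
  have "e = s (s a)" using ds e unfolding opened_def
    by (metis append_Cons append_Nil last.simps list.distinct(1) list.sel(1))
  moreover have "s a \<notin> ?X" using a disj by blast
  moreover have "s a \<in> set cs" using a X successor_in[OF s] by blast
  ultimately have "e \<notin> s ` ?X"
    using X successor_inj[OF s] by (simp add: inj_on_image_mem_iff)
  moreover have "e \<in> set cs" using ds e by (auto simp: opened_def)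
  ultimately have ex: "e \<in> ?X" using split by blast
  have say: "s a \<in> nb y" using Y a by blast
  let ?ds = "y # s a # a # x # e # es"
  have ds': "path ds" "set ds = set cs" using ds by (auto simp: opened_def cycle_def)
  have "cycle ?ds"
  proof -
    have ne: "x \<notin> set ds" "y \<notin> set ds" using xy ds' by simp_all
    have p: "path (e # es)" "a \<in> V" "s a \<in> V" "a \<noteq> s a" "{a, s a} \<inter> set (e # es) = {}"
      using ds'(1) unfolding e(1) by (auto simp: path_Cons)
    have "adj a x" "adj (s a) a" "adj b y"
      using a bY successor_adj[OF s, of a] X adj_sym by auto
    moreover have "adj x e" "adj y (s a)" using ex say by simp_all
    ultimately have "path ?ds"
      using p ne x y xy(1) unfolding e(1) by (auto simp: path_Cons)
    then show ?thesis using \<open>adj b y\<close> e(2) es by (simp add: cycle_def)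
  qed
  moreover have "set ?ds = insert x (insert y (set ds))" unfolding e(1) by auto
  then have "set ?ds = V" using ds'(2) V by simp
  ultimately show False using nonham by blast
qed

text \<open>
  Let \<open>X\<close> and \<open>Y\<close> be the neighbours of \<open>x\<close> and \<open>y\<close> on the cycle, \<open>U\<close> their union and \<open>I\<close> their
  intersection. No element of \<open>U\<close> is followed by another one, as \<open>x\<close>, \<open>y\<close> or both could be inserted
  between them. The vertex two places after an element of \<open>X\<close> is not in \<open>Y\<close>, as the vertex in between
  could be replaced by \<open>x\<close> and \<open>y\<close>, giving a cycle that misses a single vertex. So \<open>U\<close>, its
  successors, and the second successors of \<open>I\<close> are disjoint, whence
  \<open>2 * card U + card I \<le> 2 * k\<close>, while \<open>card U + card I = 2 * k - 2\<close>. This gives \<open>card U \<le> 2\<close>,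
  \<open>k \<le> 3\<close> and, with a closer look at \<open>k = 2\<close>, that \<open>I\<close> is not empty. But an element of \<open>I\<close> has four neighbours: \<open>x\<close>, \<open>y\<close> and its two neighbours on the
  cycle.
\<close>
lemma no_cycle_missing_adjacent_pair:
  assumes nonham: "\<nexists>ds. cycle ds \<and> set ds = V" and cyc: "cycle cs"
    and V: "V = insert x (insert y (set cs))" and xy: "x \<noteq> y" "x \<notin> set cs" "y \<notin> set cs"
    and adj: "adj x y"
  shows False
proof -
  have C: "set cs \<subseteq> V" and x: "x \<in> V" and y: "y \<in> V" using V by auto
  have cC: "card (set cs) = 2 * k" using order V xy by simp
  obtain s where s: "successor cs s" using ex_successor[OF cyc] by blast
  define X where "X = nb x \<inter> set cs"
  define Y where "Y = nb y \<inter> set cs"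
  have nbx: "nb x = insert y X"
    using nb_subset[of x] V adj adj_irrefl[of x] unfolding X_def by auto
  have nby: "nb y = insert x Y"
    using nb_subset[of y] V adj_sym[OF adj] adj_irrefl[of y] unfolding Y_def by auto
  have fin: "finite X" "finite Y" by (auto simp: X_def Y_def)
  have "y \<notin> X" "x \<notin> Y" using xy by (simp_all add: X_def Y_def)
  then have cX: "card X + 1 = k" and cY: "card Y + 1 = k"
    using degree[OF x] degree[OF y] fin unfolding nbx nby by simp_all
  have max: "\<not> (cycle ds \<and> set ds = insert z (set cs))" if "z \<in> {x, y}" for z ds
  proof
    assume ds: "cycle ds \<and> set ds = insert z (set cs)"
    moreover have "z \<notin> set cs" using xy that by blast
    ultimately have "card (set ds) = 2 * k + 1" using cC by simp
    then show False using no_cycle_missing_one[OF nonham, of ds] ds by simp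
  qed
  have same: "s c \<notin> nb z" if z: "z \<in> {x, y}" and c: "c \<in> nb z \<inter> set cs" for z c
  proof
    assume "s c \<in> nb z"
    moreover have "z \<in> V" "z \<notin> set cs" using z x y xy by auto
    ultimately have "\<exists>ds. cycle ds \<and> set ds = insert z (set cs)"
      using cycle_insert[OF s, of c z] c by simp
    then show False using max[OF z] by blast
  qed
  have pair: "adj z z' \<and> z \<in> V \<and> z' \<in> V \<and> z \<notin> set cs \<and> z' \<notin> set cs"
    and pair_V: "V = insert z (insert z' (set cs))"
    if "{z, z'} = {x, y}" "z \<noteq> z'" for z z'
  proof -
    consider "z = x" "z' = y" | "z = y" "z' = x" using \<open>{z, z'} = {x, y}\<close> by (auto simp: doubleton_eq_iff)
    then have "adj z z' \<and> z \<in> V \<and> z' \<in> V \<and> z \<notin> set cs \<and> z' \<notin> set cs \<and>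
        V = insert z (insert z' (set cs))"
    proof cases
      case 1
      then show ?thesis using adj x y xy V by blast
    next
      case 2
      then show ?thesis using adj_sym[OF adj] x y xy V by blast
    qed
    then show "adj z z' \<and> z \<in> V \<and> z' \<in> V \<and> z \<notin> set cs \<and> z' \<notin> set cs"
      and "V = insert z (insert z' (set cs))" by blast+
  qed
  \<comment> \<open>Insert \<open>z\<close> and \<open>z'\<close> between \<open>c\<close> and \<open>s c\<close>.\<close>
  have next1: "s c \<notin> nb z'" if z: "{z, z'} = {x, y}" "z \<noteq> z'" and c: "c \<in> nb z \<inter> set cs" for z z' c
  proof
    assume sc: "s c \<in> nb z'"
    obtain ds where ds: "opened cs s c ds" using s c by (auto simp: successor_def)
    have dd: "path ds" "set ds = set cs" "hd ds = s c" "last ds = c" "ds \<noteq> []"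
      using ds by (auto simp: opened_def cycle_def)
    have "adj c z" using c adj_sym by simp
    then have "cycle (z # z' # ds)"
      using dd sc pair[OF z] z(2) by (cases ds) (simp_all add: cycle_def path_Cons)
    moreover have "set (z # z' # ds) = V" using dd pair_V[OF z] by simp
    ultimately show False using nonham by blast
  qed
  \<comment> \<open>Replace \<open>s c\<close> by \<open>z\<close> and \<open>z'\<close>.\<close>
  have next2: "s (s c) \<notin> nb z'" if z: "{z, z'} = {x, y}" "z \<noteq> z'" and c: "c \<in> nb z \<inter> set cs" for z z' c
  proof
    assume sc: "s (s c) \<in> nb z'"
    obtain ds where ds: "opened cs s c ds" using s c by (auto simp: successor_def)
    obtain e es where e: "ds = s c # s (s c) # e # es" "last (e # es) = c"
      using opened_decomp[OF ds] by blast
    have dd: "path ds" "set ds = set cs" using ds by (auto simp: opened_def cycle_def)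
    have ne: "s (s c) \<noteq> z" "s (s c) \<noteq> z'" "e \<noteq> z" "e \<noteq> z'" "z \<notin> set es" "z' \<notin> set es"
      using pair[OF z] unfolding dd(2)[symmetric] e(1) by auto
    have "adj c z" using c adj_sym by simp
    let ?ds = "z # z' # s (s c) # e # es"
    have "cycle ?ds"
    proof -
      have "path (s (s c) # e # es)" using dd(1) unfolding e(1) by (simp add: path_Cons)
      then have "path ?ds" using sc pair[OF z] z(2) ne by (simp add: path_Cons)
      then show ?thesis using \<open>adj c z\<close> e(2) by (simp add: cycle_def)
    qed
    moreover have "card (set ?ds) = 2 * k + 1"
    proof -
      have "length ds = 2 * k" using dd cC distinct_card[of ds] by (simp add: path_def)
      then have "length ?ds = 2 * k + 1" using e by simp
      moreover have "distinct ?ds" using \<open>cycle ?ds\<close> by (simp add: cycle_def path_def)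
      ultimately show ?thesis by (simp only: distinct_card)
    qed
    ultimately show False using no_cycle_missing_one[OF nonham] by blast
  qed
  define U where "U = X \<union> Y"
  define I where "I = X \<inter> Y"
  have UC: "U \<subseteq> set cs" "I \<subseteq> U" by (auto simp: U_def I_def X_def Y_def)
  have sC: "s ` A \<subseteq> set cs" if "A \<subseteq> set cs" for A using that successor_in[OF s] by blast
  have csA: "card (s ` A) = card A" if "A \<subseteq> set cs" for A
    using that successor_inj[OF s] by (metis card_image inj_on_subset)
  have sX: "s c \<notin> U" if "c \<in> X" for c
    using same[of x c] next1[of x y c] xy(1) that unfolding U_def X_def Y_def by simp
  have sY: "s c \<notin> U" if "c \<in> Y" for c
    using same[of y c] next1[of y x c] xy(1) that unfolding U_def X_def Y_def
    by (simp add: insert_commute)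
  have ssX: "s (s c) \<notin> Y" if "c \<in> X" for c
    using next2[of x y c] xy(1) that unfolding X_def Y_def by simp
  have ssY: "s (s c) \<notin> X" if "c \<in> Y" for c
    using next2[of y x c] xy(1) that unfolding X_def Y_def by (simp add: insert_commute)
  have d1: "U \<inter> s ` U = {}"
    using sX sY by (auto simp: U_def)
  have d2: "U \<inter> s ` s ` I = {}"
    using ssX ssY by (auto simp: U_def I_def)
  have d3: "s ` U \<inter> s ` s ` I = {}"
  proof -
    have "U \<inter> s ` I = {}" using d1 UC by blast
    then show ?thesis using inj_on_image_Int[OF successor_inj[OF s] UC(1) sC[of I]] UC by auto
  qed
  have finU: "finite U" "finite I" using fin by (auto simp: U_def I_def)
  have "card (U \<union> s ` U \<union> s ` s ` I) = card U + card U + card I"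
  proof -
    have "card (s ` U) = card U" "card (s ` s ` I) = card I"
      using csA UC sC[of I] by (metis, metis order_trans)
    moreover have "card (U \<union> s ` U) = card U + card (s ` U)"
      using finU d1 by (intro card_Un_disjoint) auto
    moreover have "card ((U \<union> s ` U) \<union> s ` s ` I) = card (U \<union> s ` U) + card (s ` s ` I)"
      using finU d2 d3 by (intro card_Un_disjoint) auto
    ultimately show ?thesis by simp
  qed
  moreover have "U \<union> s ` U \<union> s ` s ` I \<subseteq> set cs" using UC sC[of U] sC[of "s ` I"] sC[of I] by blast
  ultimately have upper: "2 * card U + card I \<le> 2 * k"
    using cC card_mono[of "set cs" "U \<union> s ` U \<union> s ` s ` I"] by simp
  have sum: "card U + card I + 2 = 2 * k"
    using card_Un_Int[OF fin] cX cY by (simp add: U_def I_def)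
  have U2: "card U \<le> 2" using upper sum by simp
  have XU: "card X \<le> card U" using finU by (auto simp: U_def intro: card_mono)
  have k3: "k \<le> 3" using U2 XU cX by simp
  have "I \<noteq> {}"
  proof
    \<comment> \<open>The counting leaves the case \<open>k = 2\<close>: the cycle has four vertices, two of them in \<open>U\<close>, and the
      second successor of the only element \<open>a\<close> of \<open>X\<close> could only be \<open>a\<close> itself.\<close>
    assume I0: "I = {}"
    have "card X \<noteq> 0" using cX degree_ge_2 by simp
    then obtain a where a: "a \<in> X" by fastforce
    have "card U = 2" using I0 sum U2 degree_ge_2 by simp
    then have k2: "k = 2" using sum I0 by simp
    then have "card (U \<union> s ` U) = 4" using \<open>card U = 2\<close> csA[OF UC(1)] d1 finU
      by (subst card_Un_disjoint) auto
    then have cover: "U \<union> s ` U = set cs" using k2 cC UC sC[OF UC(1)]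
      by (intro card_subset_eq) auto
    have aC: "a \<in> set cs" "a \<in> U" using a by (auto simp: X_def U_def)
    have "s a \<notin> U" using d1 aC by blast
    then have "s (s a) \<notin> s ` U"
      using successor_inj[OF s] successor_in[OF s aC(1)] UC by (simp add: inj_on_image_mem_iff)
    then have "s (s a) \<in> U" using cover successor_in[OF s] aC by blast
    moreover have "s (s a) \<notin> Y" using ssX a by blast
    ultimately have "s (s a) \<in> X" by (simp add: U_def)
    moreover have "card X = 1" using cX k2 by simp
    ultimately have "s (s a) = a" using a by (metis card_1_singletonE singletonD)
    then show False using successor_twice_neq[OF s aC(1)] by blast
  qed
  then obtain a where a: "a \<in> I" by blast
  have aC: "a \<in> set cs" using a UC by blast
  then obtain b where b: "b \<in> set cs" "a = s b" using successor_surj[OF s] by blast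
  have "adj x a" "adj y a" "adj a (s a)" "adj b a"
    using a b successor_adj[OF s aC] successor_adj[OF s b(1)] by (simp_all add: I_def X_def Y_def)
  then have "{x, y, s a, b} \<subseteq> nb a" by (simp add: adj_sym)
  then have "card {x, y, s a, b} \<le> card (nb a)" using finite_nb card_mono by blast
  then have "card {x, y, s a, b} \<le> k" using degree[of a] aC C by auto
  moreover have "s a \<noteq> b" using successor_twice_neq[OF s b(1)] b by simp
  moreover have "s a \<noteq> x" "s a \<noteq> y" "b \<noteq> x" "b \<noteq> y" using xy b successor_in[OF s aC] by metis+
  ultimately have "card {x, y, s a, b} = 4" using xy(1) by simp
  then show False using k3 \<open>card {x, y, s a, b} \<le> k\<close> by simp
qed

lemma long_cycle_imp_hamiltonian_cycle:
  assumes cyc: "cycle cs" and long: "2 * k \<le> length cs"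
  shows "\<exists>ds. cycle ds \<and> set ds = V"
proof (rule ccontr)
  assume nonham: "\<not> ?thesis"
  have C: "set cs \<subseteq> V" and dist: "distinct cs" using cyc by (auto simp: cycle_def path_def)
  have card: "card (set cs) = length cs" using dist distinct_card by blast
  have "length cs \<noteq> 2 * k + 2"
    using card order C nonham cyc finite_V card_subset_eq by metis
  moreover have "length cs \<noteq> 2 * k + 1" using no_cycle_missing_one[OF nonham cyc] card by simp
  moreover have "length cs \<le> 2 * k + 2" using cyc path_length_le by (simp add: cycle_def)
  ultimately have "card (V - set cs) = 2" using long card C order by (simp add: card_Diff_subset)
  then obtain x y where "V - set cs = {x, y}" "x \<noteq> y" by (auto simp: card_2_iff)
  then have xy: "V = insert x (insert y (set cs))" "x \<noteq> y" "x \<notin> set cs" "y \<notin> set cs"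
    using C by auto
  show False
    using no_cycle_missing_adjacent_pair[OF nonham cyc xy]
      no_cycle_missing_nonadjacent_pair[OF nonham cyc xy] by blast
qed

section \<open>Long cycles from a longest path\<close>

text \<open>
  This lemma and the next two give the segments by positions, because the chords at the ends of a
  longest path are counted by their positions.
\<close>
lemma crossing_chords_at:
  assumes p: "path xs" and ij: "1 \<le> i" "i \<le> j" "j < length xs" "3 \<le> i + (length xs - j)"
    and e: "adj (xs ! 0) (xs ! j)" "adj (xs ! (i - 1)) (xs ! (length xs - 1))"
  obtains cs where "cycle cs" "length cs + (j - i) = length xs" "i = j \<Longrightarrow> set cs = set xs"
proof -
  let ?m = "length xs"
  have xs: "slice xs 0 i @ slice xs i j @ slice xs j ?m = xs"
    using ij slice_full[of xs] by (simp add: slice_append)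
  have "cycle (rev (slice xs 0 i) @ slice xs j ?m)"
  proof (rule cycle_from_crossing_chords)
    show "path (slice xs 0 i @ slice xs i j @ slice xs j ?m)" using p xs by simp
    show "slice xs 0 i \<noteq> []" "slice xs j ?m \<noteq> []" using ij by (simp_all add: slice_eq_Nil)
    show "3 \<le> length (slice xs 0 i) + length (slice xs j ?m)" using ij by (simp add: length_slice)
    show "adj (hd (slice xs 0 i)) (hd (slice xs j ?m))" using ij e by (simp add: hd_slice)
    show "adj (last (slice xs j ?m)) (last (slice xs 0 i))" using ij e adj_sym by (simp add: last_slice)
  qed
  moreover have "length (rev (slice xs 0 i) @ slice xs j ?m) + (j - i) = ?m"
    using ij by (simp add: length_slice)
  moreover have "set (rev (slice xs 0 i) @ slice xs j ?m) = set xs" if "i = j"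
  proof -
    have "set xs = set (slice xs 0 j @ slice xs j ?m)"
      using ij by (simp only: slice_append slice_full less_imp_le zero_le)
    then show ?thesis using that by simp
  qed
  ultimately show ?thesis using that by blast
qed

lemma end_chords_and_bridge_at:
  assumes p: "path xs" and ij: "i < i'" "i' \<le> j'" "j' < j" "j < length xs"
    and e: "adj (xs ! i) (xs ! j)" "adj (xs ! 0) (xs ! i')" "adj (xs ! j') (xs ! (length xs - 1))"
  obtains cs where "cycle cs" "length cs + card {i<..<i'} + card {j'<..<j} = length xs"
proof -
  let ?m = "length xs"
  let ?as = "slice xs 0 (Suc i)" and ?gs = "slice xs (Suc i) i'" and ?bs = "slice xs i' (Suc j')"
    and ?hs = "slice xs (Suc j') j" and ?cs = "slice xs j ?m"
  have xs: "?as @ ?gs @ ?bs @ ?hs @ ?cs = xs"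
    using ij slice_full[of xs] by (simp add: slice_append)
  have "cycle (rev ?as @ ?bs @ rev ?cs)"
  proof (rule cycle_from_end_chords_and_bridge)
    show "path (?as @ ?gs @ ?bs @ ?hs @ ?cs)" using p xs by simp
    show "?as \<noteq> []" "?bs \<noteq> []" "?cs \<noteq> []" using ij by (simp_all add: slice_eq_Nil)
    show "adj (hd ?cs) (last ?as)" using ij e adj_sym by (simp add: hd_slice last_slice)
    show "adj (hd ?as) (hd ?bs)" using ij e by (simp add: hd_slice)
    show "adj (last ?bs) (last ?cs)" using ij e by (simp add: last_slice)
  qed
  moreover have "length (rev ?as @ ?bs @ rev ?cs) + card {i<..<i'} + card {j'<..<j} = ?m"
    using ij by (simp add: length_slice)
  ultimately show ?thesis using that by blast
qed

lemma two_bridges_at: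
  assumes p: "path xs" and ij: "i < p" "Suc p < j" "j < length xs"
    and e: "adj (xs ! 0) (xs ! Suc i)" "adj (xs ! p) (xs ! j)"
      "adj (xs ! (j - 1)) (xs ! (length xs - 1))" "adj (xs ! i) (xs ! Suc p)"
  obtains cs where "cycle cs" "length cs = length xs"
proof -
  let ?m = "length xs"
  let ?as = "slice xs 0 (Suc i)" and ?bs = "slice xs (Suc i) (Suc p)" and ?cs = "slice xs (Suc p) j"
    and ?ds = "slice xs j ?m"
  have xs: "?as @ ?bs @ ?cs @ ?ds = xs"
    using ij slice_full[of xs] by (simp add: slice_append)
  have "cycle (rev ?as @ ?bs @ ?ds @ rev ?cs)"
  proof (rule cycle_from_two_bridges)
    show "path (?as @ ?bs @ ?cs @ ?ds)" using p xs by simp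
    show "?as \<noteq> []" "?bs \<noteq> []" "?cs \<noteq> []" "?ds \<noteq> []" using ij by (simp_all add: slice_eq_Nil)
    show "adj (hd ?as) (hd ?bs)" using ij e by (simp add: hd_slice)
    show "adj (last ?bs) (hd ?ds)" using ij e by (simp add: hd_slice last_slice)
    show "adj (last ?ds) (last ?cs)" using ij e adj_sym by (simp add: last_slice)
    show "adj (hd ?cs) (last ?as)" using ij e adj_sym by (simp add: hd_slice last_slice)
  qed
  moreover have "length (rev ?as @ ?bs @ ?ds @ rev ?cs) = ?m"
    using ij by (simp add: length_slice)
  ultimately show ?thesis using that by blast
qed

lemma longer_path_at:
  assumes p: "path xs" and i: "Suc i < length xs" and e: "adj (xs ! 0) (xs ! Suc i)"
    and z: "z \<notin> set xs" "adj (xs ! i) z"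
  obtains ys where "path ys" "length xs < length ys"
proof -
  let ?as = "slice xs 0 (Suc i)" and ?bs = "slice xs (Suc i) (length xs)"
  have xs: "?as @ ?bs = xs"
    using i slice_full[of xs] by (simp add: slice_append)
  have ne: "?as \<noteq> []" "?bs \<noteq> []" using i by (simp_all add: slice_eq_Nil)
  have "path ?as" "path ?bs" "set ?as \<inter> set ?bs = {}" using p xs path_append[of ?as ?bs] by auto
  moreover have "z \<notin> set ?as" "z \<notin> set ?bs" using z xs by (metis Un_iff set_append)+
  moreover have "adj (hd ?as) (hd ?bs)" using i e by (simp add: hd_slice)
  moreover have "adj z (last ?as)" using i z adj_sym by (simp add: last_slice)
  moreover have "z \<in> V" using z adj_in by blast
  ultimately have "path (z # rev ?as @ ?bs)"
    using ne by (simp add: path_Cons path_append last_rev hd_append hd_rev)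
  moreover have "length (z # rev ?as @ ?bs) = Suc (length xs)" using i by (simp add: length_slice)
  ultimately show ?thesis using that by (metis lessI)
qed

definition longest_path :: "'a list \<Rightarrow> bool" where
  "longest_path xs \<longleftrightarrow> path xs \<and> (\<forall>ys. path ys \<longrightarrow> length ys \<le> length xs)"

lemma ex_longest_path: "\<exists>xs. longest_path xs"
proof -
  have "\<forall>ys. path ys \<longrightarrow> length ys < 2 * k + 3" using path_length_le by fastforce
  then show ?thesis
    unfolding longest_path_def using ex_has_greatest_nat[of path "[]" length "2 * k + 3"] by simp
qed

lemma longest_path_nonempty: "longest_path xs \<Longrightarrow> xs \<noteq> []"
proof
  assume xs: "longest_path xs" "xs = []"
  obtain v where "v \<in> V" using order by fastforce
  then have "path [v]" by (simp add: path_Cons)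
  then show False using xs unfolding longest_path_def by fastforce
qed

text \<open>
  By connectivity an edge leaves the cycle. Opening the cycle at this edge gives a longer path.
\<close>
lemma longest_path_not_closable:
  assumes xs: "longest_path xs" and nonham: "\<nexists>ds. cycle ds \<and> set ds = V"
    and cs: "cycle cs" "set cs = set xs"
  shows False
proof -
  have "set xs \<subseteq> V" "set xs \<noteq> V" using xs cs nonham by (auto simp: longest_path_def path_def)
  moreover have "set xs \<noteq> {}" using longest_path_nonempty[OF xs] by simp
  ultimately obtain u w where u: "u \<in> set xs" and w: "w \<in> V" "w \<notin> set xs" "adj u w"
    using edge_leaving[of "set xs"] by blast
  obtain as bs where "cs = as @ u # bs" using u cs by (metis split_list)
  then have rot: "rotate (length as) cs = u # bs @ as"
    using rotate_append[of as "u # bs"] by simp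
  have "cycle (u # bs @ as)" using cycle_rotate[OF cs(1)] rot by metis
  moreover have "set (u # bs @ as) = set xs" using rot cs by (metis set_rotate)
  ultimately have "path (w # u # bs @ as)"
    using w adj_sym by (simp add: cycle_def path_Cons)
  then have "length (w # u # bs @ as) \<le> length xs" using xs unfolding longest_path_def by blast
  moreover have "length (u # bs @ as) = length cs" using rot by (metis length_rotate)
  moreover have "length cs = length xs"
    using xs cs by (metis distinct_card longest_path_def path_def cycle_def)
  ultimately show False by simp
qed

definition start_chords :: "'a list \<Rightarrow> nat set" where
  "start_chords xs = {i \<in> {1..<length xs}. adj (xs ! 0) (xs ! i)}"

text \<open>
  A neighbour of the last vertex is recorded by the position after it. In this way a position that lies
  in both sets of chords closes the path to a cycle, and both sets are subsets of \<open>{1..<length xs}\<close>.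
\<close>
definition end_chords :: "'a list \<Rightarrow> nat set" where
  "end_chords xs = {i \<in> {1..<length xs}. adj (xs ! (i - 1)) (xs ! (length xs - 1))}"

lemma card_start_chords:
  assumes xs: "longest_path xs"
  shows "card (start_chords xs) = k"
proof -
  have ne: "xs \<noteq> []" using longest_path_nonempty[OF xs] .
  have p: "path xs" using xs by (simp add: longest_path_def)
  have "nb (xs ! 0) \<subseteq> set xs"
  proof (rule ccontr)
    assume "\<not> ?thesis"
    then obtain w where w: "adj (xs ! 0) w" "w \<notin> set xs" by blast
    then have "path (w # xs)" using p ne adj_in adj_sym by (simp add: path_Cons hd_conv_nth)
    then show False using xs unfolding longest_path_def by fastforce
  qed
  have "nb (xs ! 0) \<subseteq> (!) xs ` start_chords xs"
  proof
    fix w assume w: "w \<in> nb (xs ! 0)"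
    then obtain i where i: "i < length xs" "w = xs ! i"
      using \<open>nb (xs ! 0) \<subseteq> set xs\<close> by (metis in_set_conv_nth subsetD)
    then have "i \<noteq> 0" using w adj_irrefl by (metis mem_Collect_eq)
    then have "i \<in> start_chords xs" using i w by (simp add: start_chords_def)
    then show "w \<in> (!) xs ` start_chords xs" using i by blast
  qed
  then have "nb (xs ! 0) = (!) xs ` start_chords xs" by (auto simp: start_chords_def)
  moreover have "inj_on ((!) xs) (start_chords xs)"
    using p by (intro inj_on_nth) (auto simp: start_chords_def path_def)
  moreover have "xs ! 0 \<in> V" using p ne by (auto simp: path_def)
  ultimately show ?thesis using degree[of "xs ! 0"] card_image by metis
qed

lemma card_end_chords:
  assumes xs: "longest_path xs"
  shows "card (end_chords xs) = k"
proof -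
  let ?m = "length xs"
  have rev: "longest_path (rev xs)" using xs by (simp add: longest_path_def)
  have mirror: "?m - i \<in> end_chords xs \<longleftrightarrow> i \<in> start_chords (rev xs)" if "1 \<le> i" "i < ?m" for i
  proof -
    have "rev xs ! 0 = xs ! (?m - 1)" "rev xs ! i = xs ! (?m - i - 1)" using that
      by (subst rev_nth, auto)+
    then show ?thesis using that adj_sym unfolding start_chords_def end_chords_def by auto
  qed
  have range: "1 \<le> i \<and> i < ?m" if "i \<in> start_chords (rev xs) \<or> i \<in> end_chords xs" for i
    using that by (auto simp: start_chords_def end_chords_def)
  have "bij_betw (\<lambda>i. ?m - i) (start_chords (rev xs)) (end_chords xs)"
  proof (rule bij_betw_byWitness[where f' = "\<lambda>i. ?m - i"])
    show "(\<lambda>i. ?m - i) ` start_chords (rev xs) \<subseteq> end_chords xs"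
      using mirror range by blast
    show "(\<lambda>i. ?m - i) ` end_chords xs \<subseteq> start_chords (rev xs)"
    proof
      fix j assume "j \<in> (\<lambda>i. ?m - i) ` end_chords xs"
      then obtain i where i: "i \<in> end_chords xs" "j = ?m - i" by blast
      then show "j \<in> start_chords (rev xs)" using mirror[of j] range[of i] by auto
    qed
    show "\<forall>i\<in>start_chords (rev xs). ?m - (?m - i) = i" "\<forall>i\<in>end_chords xs. ?m - (?m - i) = i"
      using range by fastforce+
  qed
  then show ?thesis using card_start_chords[OF rev] bij_betw_same_card by metis
qed

lemma longest_path_length_ge_3:
  assumes xs: "longest_path xs"
  shows "3 \<le> length xs"
proof -
  have "card (start_chords xs) \<le> card {1..<length xs}"
    unfolding start_chords_def by (intro card_mono) auto
  then show ?thesis using card_start_chords[OF xs] degree_ge_2 by simp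
qed

lemma chords_disjoint:
  assumes xs: "longest_path xs" and nonham: "\<nexists>ds. cycle ds \<and> set ds = V"
  shows "start_chords xs \<inter> end_chords xs = {}"
proof (rule ccontr)
  assume "\<not> ?thesis"
  then obtain i where i: "i \<in> start_chords xs" "i \<in> end_chords xs" by blast
  have "path xs" using xs by (simp add: longest_path_def)
  then obtain cs where "cycle cs" "set cs = set xs"
    using i longest_path_length_ge_3[OF xs]
    by (auto simp: start_chords_def end_chords_def elim: crossing_chords_at[of xs i i])
  then show False using longest_path_not_closable[OF xs nonham] by blast
qed

lemma cut_edge:
  assumes p: "path xs" and c: "1 \<le> c" "c + 1 < length xs"
  obtains i w where "i < c" "adj (xs ! i) w" "w \<in> V" "w \<noteq> xs ! c" "\<And>j. j < c \<Longrightarrow> w \<noteq> xs ! j"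
proof -
  let ?S = "(!) xs ` {..<c}"
  have d: "distinct xs" and sub: "set xs \<subseteq> V" using p by (auto simp: path_def)
  have "xs ! c \<in> V" using sub c by auto
  moreover have "?S \<subseteq> V - {xs ! c}" using sub d c by (auto simp: nth_eq_iff_index_eq)
  moreover have "?S \<noteq> {}" using c by (simp add: lessThan_empty_iff)
  moreover have "xs ! (c + 1) \<in> V - {xs ! c}" "xs ! (c + 1) \<notin> ?S"
    using sub d c by (auto simp: nth_eq_iff_index_eq)
  then have "?S \<noteq> V - {xs ! c}" by blast
  ultimately obtain u w where "u \<in> ?S" "w \<in> V - {xs ! c} - ?S" "adj u w"
    using edge_leaving_avoiding_vertex[of "xs ! c" ?S] by blast
  then show ?thesis using that by blast
qed

text \<open>
  Let \<open>A\<close> and \<open>B\<close> be the chord positions of the two ends of a longest path with \<open>m\<close> vertices. They are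
  disjoint, so \<open>2 * k + 1 \<le> m\<close>, and at most one position is a gap, that is, belongs to neither. A
  cycle that skips as many vertices as there are gaps, or one more, is long.

  With crossing chords a closest pair works. Otherwise every position in \<open>A\<close> is at most \<open>p\<close> and every
  position in \<open>B\<close> at least \<open>q > p\<close>. An edge over position \<open>p\<close> whose far end is at \<open>q\<close> or later gives a long
  cycle. The remaining possibility is that the edge ends at the gap \<open>p + 1\<close> and \<open>q = p + 2\<close>; then an edge
  over position \<open>p + 1\<close> is needed as well.
\<close>
lemma ex_long_cycle:
  assumes nonham: "\<nexists>ds. cycle ds \<and> set ds = V"
  shows "\<exists>cs. cycle cs \<and> 2 * k \<le> length cs"
proof (rule ccontr)
  assume "\<not> ?thesis"
  then have short: "length cs < 2 * k" if "cycle cs" for cs using that by force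
  obtain xs where xs: "longest_path xs" using ex_longest_path by blast
  define m where "m = length xs"
  define A where "A = start_chords xs"
  define B where "B = end_chords xs"
  have p: "path xs" and max: "\<And>ys. path ys \<Longrightarrow> length ys \<le> m"
    using xs by (auto simp: longest_path_def m_def)
  have d: "distinct xs" and sub: "set xs \<subseteq> V" using p by (auto simp: path_def)
  have A: "i \<in> A \<longleftrightarrow> 1 \<le> i \<and> i < m \<and> adj (xs ! 0) (xs ! i)" for i
    by (auto simp: A_def start_chords_def m_def)
  have B: "i \<in> B \<longleftrightarrow> 1 \<le> i \<and> i < m \<and> adj (xs ! (i - 1)) (xs ! (m - 1))" for i
    by (auto simp: B_def end_chords_def m_def)
  have cA: "card A = k" and cB: "card B = k"
    using card_start_chords[OF xs] card_end_chords[OF xs] by (simp_all add: A_def B_def)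
  have AB: "A \<inter> B = {}" using chords_disjoint[OF xs nonham] by (simp add: A_def B_def)
  have AI: "A \<subseteq> {1..<m}" and BI: "B \<subseteq> {1..<m}"
    by (auto simp: A_def start_chords_def B_def end_chords_def m_def)
  have fin: "finite A" "finite B" using AI BI finite_subset by auto
  have m3: "3 \<le> m" using longest_path_length_ge_3[OF xs] by (simp add: m_def)
  define gap where "gap = {1..<m} - (A \<union> B)"
  have "card (A \<union> B) = 2 * k" using cA cB AB fin by (simp add: card_Un_disjoint)
  moreover have "card {1..<m} = card (A \<union> B) + card gap"
    unfolding gap_def using AI BI fin card_mono[of "{1..<m}" "A \<union> B"] by (simp add: card_Diff_subset)
  ultimately have gap: "2 * k + card gap + 1 = m" using m3 by simp
  have fgap: "finite gap" by (simp add: gap_def)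
  have m_le: "m \<le> 2 * k + 2" using path_length_le[OF p] by (simp add: m_def)
  \<comment> \<open>Between the positions of a closest pair of crossing chords there are only gaps.\<close>
  have separated: "j < i" if "i \<in> B" "j \<in> A" for i j
  proof (rule ccontr)
    assume "\<not> j < i"
    then have ex: "\<exists>l i j. i \<in> B \<and> j \<in> A \<and> i \<le> j \<and> l = j - i" using that by force
    define l where "l = (LEAST l. \<exists>i j. i \<in> B \<and> j \<in> A \<and> i \<le> j \<and> l = j - i)"
    obtain i j where ij: "i \<in> B" "j \<in> A" "i \<le> j" "l = j - i"
      using LeastI_ex[OF ex] unfolding l_def by blast
    have least: "l \<le> j' - i'" if "i' \<in> B" "j' \<in> A" "i' \<le> j'" for i' j'
      unfolding l_def by (rule Least_le) (use that in blast)
    have "{i<..<j} \<subseteq> gap"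
    proof
      fix t assume t: "t \<in> {i<..<j}"
      have "t \<notin> A" using least[of i t] ij t by auto
      moreover have "t \<notin> B" using least[of t j] ij t by auto
      moreover have "j < m" using ij A by blast
      ultimately show "t \<in> gap" using t by (auto simp: gap_def)
    qed
    then have "card {i<..<j} \<le> card gap" using fgap card_mono by blast
    then have ji: "j - i \<le> m - 2 * k" using gap by simp
    have i1: "1 \<le> i" "j < m" using ij A B by simp_all
    have "i \<noteq> j" using ij AB by blast
    have h3: "3 \<le> i + (length xs - j)" using i1 ji \<open>i \<noteq> j\<close> ij(3) m_le gap degree_ge_2 
      unfolding m_def by linarith
    then obtain cs where "cycle cs" "length cs + (j - i) = m"
      using ij(1,2) A[of j] B[of i] crossing_chords_at[OF p i1(1) ij(3) _ h3] unfolding m_def by metis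
    then show False using short[of cs] ji gap by simp
  qed
  define p where "p = Max A"
  define q where "q = Min B"
  have ne: "A \<noteq> {}" "B \<noteq> {}" using cA cB degree_ge_2 by auto
  have pA: "p \<in> A" and qB: "q \<in> B" and Ap: "\<And>i. i \<in> A \<Longrightarrow> i \<le> p" and Bq: "\<And>i. i \<in> B \<Longrightarrow> q \<le> i"
    using fin ne by (auto simp: p_def q_def)
  have pq: "p < q" using separated pA qB by blast
  have qm: "q < m" and p1: "1 \<le> p" using pA qB A[of p] B[of q] by simp_all
  \<comment> \<open>The cycle uses two further edges: from the first vertex to its neighbour at the position \<open>i'\<close>
    that comes next after \<open>i\<close>, and from the last vertex to its neighbour at the position \<open>b - 1\<close> that
    comes last before \<open>j\<close>. The vertices skipped before \<open>i'\<close> are at gaps, those skipped before \<open>j\<close>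
    just ahead of gaps.\<close>
  have no_far_bridge: False if ij: "i < p" "q \<le> j" "j < m" "adj (xs ! i) (xs ! j)" for i j
  proof -
    define i' where "i' = Min {a \<in> A. i < a}"
    define b where "b = Max {b \<in> B. b \<le> j}"
    have next_set: "finite {a \<in> A. i < a}" "{a \<in> A. i < a} \<noteq> {}" using fin pA ij(1) by auto
    have i': "i' \<in> A" "i < i'" and i'_le: "\<And>a. a \<in> A \<Longrightarrow> i < a \<Longrightarrow> i' \<le> a"
      unfolding i'_def using Min_in[OF next_set] next_set(1) by simp_all
    have prev_set: "finite {b \<in> B. b \<le> j}" "{b \<in> B. b \<le> j} \<noteq> {}" using fin qB ij(2) by auto
    have b: "b \<in> B" "b \<le> j" and b_ge: "\<And>c. c \<in> B \<Longrightarrow> c \<le> j \<Longrightarrow> c \<le> b"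
      unfolding b_def using Max_in[OF prev_set] prev_set(1) by simp_all
    have i'p: "i' \<le> p" and qb: "q \<le> b" using Ap[OF i'(1)] Bq[OF b(1)] by simp_all
    obtain cs where cs: "cycle cs" "length cs + card {i<..<i'} + card {b - 1<..<j} = m"
    proof -
      have "i' \<le> b - 1" "b - 1 < j" using i'p qb pq b(2) by simp_all
      then show ?thesis
        using that end_chords_and_bridge_at[OF \<open>path xs\<close> i'(2) _ _ _ ij(4)] ij(3) A[of i'] B[of b] i'(1) b(1)
        unfolding m_def by metis
    qed
    have "card {i<..<i'} + card {b<..j} = card ({i<..<i'} \<union> {b<..j})"
      using i'p qb pq by (subst card_Un_disjoint) auto
    also have "\<dots> \<le> card gap"
    proof (rule card_mono[OF fgap], rule subsetI)
      fix t assume t: "t \<in> {i<..<i'} \<union> {b<..j}"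
      have "t \<notin> A" using t i'_le[of t] Ap[of t] qb pq by fastforce
      moreover have "t \<notin> B" using t b_ge[of t] Bq[of t] i'p pq ij(2) by fastforce
      ultimately show "t \<in> gap" using t i'p pq qm ij(3) by (auto simp: gap_def)
    qed
    finally have "card {i<..<i'} + card {b - 1<..<j} \<le> card gap" using b qb pq by simp
    then show False using short[OF cs(1)] cs(2) gap by simp
  qed
  \<comment> \<open>An edge that leaves the path would extend it: if there is a vertex outside the path, there is no
    gap, and the path can be rerouted so as to end at position \<open>i\<close>.\<close>
  have bridge: "\<exists>i j. i < c \<and> c < j \<and> j < m \<and> adj (xs ! i) (xs ! j)"
    if c: "1 \<le> c" "c + 1 < m" "c \<le> p \<or> m = 2 * k + 2" for c
  proof -
    obtain i w where iw: "i < c" "adj (xs ! i) w" "w \<in> V" "w \<noteq> xs ! c" "\<And>j. j < c \<Longrightarrow> w \<noteq> xs ! j"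
      using cut_edge[OF \<open>path xs\<close>, of c] c by (auto simp: m_def)
    have "w \<in> set xs"
    proof (rule ccontr)
      assume w: "w \<notin> set xs"
      have "set xs \<noteq> V" using w iw by blast
      then have "m < 2 * k + 2"
        using sub finite_V order psubset_card_mono[of V "set xs"] distinct_card[OF d] by (auto simp: m_def)
      then have "gap = {}" "c \<le> p" using gap fgap c by auto
      moreover have "Suc i \<in> {1..<m}" using iw(1) \<open>c \<le> p\<close> pq qm by simp
      ultimately have "Suc i \<in> A \<union> B" unfolding gap_def by blast
      then have "Suc i \<in> A" using Bq[of "Suc i"] iw(1) \<open>c \<le> p\<close> pq by auto
      then obtain ys where "path ys" "m < length ys"
        using longer_path_at[OF \<open>path xs\<close> _ _ w iw(2)] A[of "Suc i"] unfolding m_def by metis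
      then show False using max[of ys] by simp
    qed
    then obtain j where j: "j < m" "w = xs ! j" by (auto simp: in_set_conv_nth m_def)
    then have "c < j" using iw by (metis linorder_neqE_nat)
    then show ?thesis using iw j by blast
  qed
  obtain i j where ij: "i < p" "p < j" "j < m" "adj (xs ! i) (xs ! j)"
    using bridge[of p] p1 pq qm by auto
  have "j < q" using no_far_bridge[of i j] ij by force
  have sub_gap: "{p<..<q} \<subseteq> gap"
  proof
    fix t assume "t \<in> {p<..<q}"
    then show "t \<in> gap" using Ap[of t] Bq[of t] qm by (auto simp: gap_def)
  qed
  then have "card {p<..<q} \<le> card gap" using fgap card_mono by blast
  then have q: "q = p + 2" "j = p + 1" "m = 2 * k + 2" using gap m_le ij \<open>j < q\<close> by auto
  have "gap = {p + 1}"
  proof -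
    have "{p + 1} \<subseteq> gap" using sub_gap q by auto
    moreover have "card gap = 1" using gap q by simp
    ultimately show ?thesis by (metis card_1_singletonE insert_subset singletonD)
  qed
  obtain i2 j2 where ij2: "i2 < p + 1" "p + 1 < j2" "j2 < m" "adj (xs ! i2) (xs ! j2)"
    using bridge[of "p + 1"] q qm by auto
  have "i2 = p" using no_far_bridge[of i2 j2] ij2 q by force
  have "Suc i \<in> A \<union> B" "j2 \<in> A \<union> B"
  proof -
    have "Suc i \<in> {1..<m}" "j2 \<in> {1..<m}" "Suc i \<notin> gap" "j2 \<notin> gap"
      using \<open>gap = {p + 1}\<close> ij ij2 by simp_all
    then show "Suc i \<in> A \<union> B" "j2 \<in> A \<union> B" unfolding gap_def by blast+
  qed
  then have "Suc i \<in> A" "j2 \<in> B" using Bq[of "Suc i"] Ap[of j2] ij(1) ij2(2) q by auto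
  then obtain cs where "cycle cs" "length cs = m"
  proof -
    have "adj (xs ! p) (xs ! j2)" "adj (xs ! i) (xs ! Suc p)" using ij(4) ij2(4) q(2) \<open>i2 = p\<close> by simp_all
    moreover have "Suc p < j2" using ij2(2) by simp
    ultimately show ?thesis
      using that two_bridges_at[OF \<open>path xs\<close> ij(1)] ij2(3) A[of "Suc i"] B[of j2] \<open>Suc i \<in> A\<close> \<open>j2 \<in> B\<close>
      unfolding m_def by metis
  qed
  then show False using short[of cs] q by simp
qed

lemma ex_hamiltonian_cycle: "\<exists>cs. cycle cs \<and> set cs = V"
  using ex_long_cycle long_cycle_imp_hamiltonian_cycle by blast

end

section \<open>From the vertex relation to the digraph\<close>

lemma (in nomulti_digraph) card_dominated: "card {w. u \<rightarrow> w} = out_degree G u"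
proof -
  have "{w. u \<rightarrow> w} = head G ` out_arcs G u"
    by (auto simp: arcs_ends_conv)
  moreover have "inj_on (head G) (out_arcs G u)"
    using no_multi_arcs by (auto simp: inj_on_def arc_to_ends_def)
  ultimately show ?thesis by (simp add: out_degree_def card_image)
qed

lemma (in wf_digraph) connected_if_edges_leave:
  assumes ne: "verts G \<noteq> {}"
    and leave: "\<And>S. \<lbrakk>S \<subseteq> verts G; S \<noteq> {}; S \<noteq> verts G\<rbrakk> \<Longrightarrow> \<exists>u\<in>S. \<exists>w\<in>verts G - S. u \<rightarrow> w"
  shows "connected G"
proof -
  have "u \<rightarrow>\<^sup>* v" if u: "u \<in> verts G" and v: "v \<in> verts G" for u v
  proof (rule ccontr)
    assume nv: "\<not> u \<rightarrow>\<^sup>* v"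
    let ?S = "{x \<in> verts G. u \<rightarrow>\<^sup>* x}"
    have "?S \<subseteq> verts G" by blast
    moreover have "?S \<noteq> {}" using u reachable_refl by blast
    moreover have "?S \<noteq> verts G" using v nv by blast
    ultimately obtain x w where x: "x \<in> ?S" and w: "w \<in> verts G - ?S" and xw: "x \<rightarrow> w"
      using leave by meson
    then have "u \<rightarrow>\<^sup>* w" using reachable_adj_trans by blast
    then show False using w by blast
  qed
  then have "(u, v) \<in> rtrancl_on (verts G) ((arcs_ends G)\<^sup>s)" if "u \<in> verts G" "v \<in> verts G" for u v
    using that rtrancl_on_mono[of "arcs_ends G" "(arcs_ends G)\<^sup>s" "verts G" "verts G"]
    unfolding reachable_def symcl_def by blast
  then show ?thesis using ne by (simp add: connected_conv)
qed

text \<open>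
  Passing from vertices to arcs. The walk is described by the heads of its arcs, since these are the
  vertices that a cycle of arcs visits once.
\<close>
lemma (in wf_digraph) arc_walk_of_vertex_walk:
  assumes "successively (\<lambda>u v. u \<rightarrow> v) (u # xs)"
  shows "\<exists>p. set p \<subseteq> arcs G \<and> cas u p (last (u # xs)) \<and> map (head G) p = xs"
  using assms
proof (induction xs arbitrary: u)
  case Nil
  then show ?case by (intro exI[of _ "[]"]) simp
next
  case (Cons x xs)
  then obtain p where p: "set p \<subseteq> arcs G" "cas x p (last (x # xs))" "map (head G) p = xs"
    by (auto simp: successively_Cons)
  obtain e where "e \<in> arcs G" "tail G e = u" "head G e = x"
    using Cons.prems by (auto simp: successively_Cons)
  then show ?case using p by (intro exI[of _ "e # p"]) simp
qed

lemma (in wf_digraph) hamiltonian_if_vertex_cycle: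
  assumes xs: "distinct xs" "set xs = verts G" "3 \<le> length xs"
    and walk: "successively (\<lambda>u v. u \<rightarrow> v) xs" and close: "last xs \<rightarrow> hd xs"
  shows "hamiltonian G"
proof -
  let ?u = "last xs"
  have ne: "xs \<noteq> []" using xs by auto
  have "successively (\<lambda>u v. u \<rightarrow> v) (?u # xs)" using walk close ne by (simp add: successively_Cons)
  then obtain p where p: "set p \<subseteq> arcs G" "cas ?u p (last (?u # xs))" "map (head G) p = xs"
    using arc_walk_of_vertex_walk by blast
  have pne: "p \<noteq> []" using p ne by auto
  have "awalk ?u p ?u" using p ne xs last_in_set[OF ne] by (simp add: awalk_def)
  moreover have "tl (awalk_verts ?u p) = xs" using awalk_verts_conv'[OF p(2)] pne p(3) by simp
  ultimately have "cycle p" using xs pne by (auto simp: cycle_def)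
  moreover have "3 \<le> length p" using p(3) xs by auto
  ultimately show ?thesis using p(3) xs unfolding hamiltonian_def by blast
qed

lemma (in digraph) digraph_iso_two_cliques:
  assumes S: "S \<subseteq> verts G" "card S = n" "card (verts G - S) = n"
    and ends: "arcs_ends G = {(u, w). u \<noteq> w \<and> (u \<in> S \<and> w \<in> S \<or> u \<in> verts G - S \<and> w \<in> verts G - S)}"
  shows "digraph_iso G (two_cliques n)"
proof -
  let ?T = "verts G - S"
  have "finite S" using S finite_verts finite_subset by blast
  then obtain f where f: "bij_betw f S {..<n}"
    using S ex_bij_betw_finite_nat[of S] by (metis atLeast0LessThan)
  obtain g where g: "bij_betw g ?T {..<n}"
    using S ex_bij_betw_finite_nat[of ?T] by (metis atLeast0LessThan finite_Diff finite_verts)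
  define \<phi> where "\<phi> v = (if v \<in> S then Inl (f v) else Inr (g v))" for v
  have inj: "inj_on \<phi> (verts G)"
  proof (rule inj_onI)
    fix u w assume "u \<in> verts G" "w \<in> verts G" "\<phi> u = \<phi> w"
    then show "u = w"
      using inj_onD[OF bij_betw_imp_inj_on[OF f], of u w] inj_onD[OF bij_betw_imp_inj_on[OF g], of u w]
      by (simp add: \<phi>_def split: if_splits)
  qed
  have \<phi>S: "\<phi> ` S = Inl ` {..<n}" 
  proof -
    have "\<phi> ` S = Inl ` f ` S" unfolding image_image by (rule image_cong) (simp_all add: \<phi>_def)
    then show ?thesis using bij_betw_imp_surj_on[OF f] by simp
  qed
  have \<phi>T: "\<phi> ` ?T = Inr ` {..<n}" 
  proof -
    have "\<phi> ` ?T = Inr ` g ` ?T" unfolding image_image by (rule image_cong) (simp_all add: \<phi>_def)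
    then show ?thesis using bij_betw_imp_surj_on[OF g] by simp
  qed
  have "\<phi> ` verts G = \<phi> ` S \<union> \<phi> ` ?T" using S by blast
  then have verts: "\<phi> ` verts G = {..<n} <+> {..<n}" unfolding \<phi>S \<phi>T by (simp add: Plus_def)
  have clique: "map_prod \<phi> \<phi> ` {(u, w). u \<noteq> w \<and> u \<in> R \<and> w \<in> R}
      = {(a, b). a \<noteq> b \<and> a \<in> \<phi> ` R \<and> b \<in> \<phi> ` R}" if "R \<subseteq> verts G" for R
  proof (intro equalityI subsetI)
    fix e assume "e \<in> map_prod \<phi> \<phi> ` {(u, w). u \<noteq> w \<and> u \<in> R \<and> w \<in> R}"
    then obtain u w where "e = (\<phi> u, \<phi> w)" "u \<noteq> w" "u \<in> R" "w \<in> R" by auto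
    then show "e \<in> {(a, b). a \<noteq> b \<and> a \<in> \<phi> ` R \<and> b \<in> \<phi> ` R}"
      using inj_on_eq_iff[OF inj, of u w] that by auto
  next
    fix e assume "e \<in> {(a, b). a \<noteq> b \<and> a \<in> \<phi> ` R \<and> b \<in> \<phi> ` R}"
    then obtain u w where "e = (\<phi> u, \<phi> w)" "u \<noteq> w" "u \<in> R" "w \<in> R" by auto
    then show "e \<in> map_prod \<phi> \<phi> ` {(u, w). u \<noteq> w \<and> u \<in> R \<and> w \<in> R}"
      by (intro image_eqI[of _ _ "(u, w)"]) auto
  qed
  have "map_prod \<phi> \<phi> ` arcs_ends G =
      {(a, b). a \<noteq> b \<and> a \<in> \<phi> ` S \<and> b \<in> \<phi> ` S} \<union> {(a, b). a \<noteq> b \<and> a \<in> \<phi> ` ?T \<and> b \<in> \<phi> ` ?T}"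
  proof -
    have "arcs_ends G = {(u, w). u \<noteq> w \<and> u \<in> S \<and> w \<in> S} \<union> {(u, w). u \<noteq> w \<and> u \<in> ?T \<and> w \<in> ?T}"
      unfolding ends by blast
    then show ?thesis using clique[OF S(1)] clique[of ?T] by (simp only: image_Un Diff_subset)
  qed
  also have "\<dots> = arcs (two_cliques n)"
    unfolding \<phi>S \<phi>T by (auto simp: two_cliques_def disjoint_union_def clique_def image_iff)
  finally have arcs: "map_prod \<phi> \<phi> ` arcs_ends G = arcs (two_cliques n)" .
  define h :: "('a, 'b, nat + nat, (nat + nat) \<times> (nat + nat)) digraph_isomorphism" where
    "h = \<lparr>iso_verts = \<phi>, iso_arcs = (\<lambda>e. map_prod \<phi> \<phi> (arc_to_ends G e)),
          iso_head = snd, iso_tail = fst\<rparr>"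
  have "inj_on (iso_arcs h) (arcs G)"
  proof (rule inj_onI)
    fix e e' assume e: "e \<in> arcs G" "e' \<in> arcs G" "iso_arcs h e = iso_arcs h e'"
    then have "arc_to_ends G e = arc_to_ends G e'"
      using inj by (auto simp: h_def arc_to_ends_def dest: inj_onD)
    then show "e = e'" using e no_multi_arcs by blast
  qed
  then have "digraph_isomorphism h"
    using inj wf_digraph by (simp add: digraph_isomorphism_def h_def arc_to_ends_def)
  moreover have "two_cliques n = app_iso h G"
  proof (rule pre_digraph.equality)
    show "arcs (two_cliques n) = arcs (app_iso h G)"
      using arcs by (simp add: h_def arcs_ends_def image_image)
    show "verts (two_cliques n) = verts (app_iso h G)"
      using verts by (simp add: h_def verts_two_cliques)
  qed (simp_all add: two_cliques_def h_def)
  ultimately show ?thesis unfolding digraph_iso_def by blast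
qed

text \<open>
  In a set of \<open>n\<close> vertices without outgoing edges every vertex is adjacent to all \<open>n - 1\<close> others, and by
  symmetry the same holds in its complement. So such a set would make the graph two cliques.
\<close>
lemma half_regular_if_two_clique_class:
  assumes n: "0 < n" and G: "G \<in> two_clique_class n"
  shows "half_regular (verts G) (\<lambda>u v. u \<rightarrow>\<^bsub>G\<^esub> v) (n - 1)"
proof -
  have gr: "graph G" and card: "card (verts G) = 2 * n"
    and deg: "\<And>v. v \<in> verts G \<Longrightarrow> out_degree G v = n - 1"
    and niso: "\<not> digraph_iso G (two_cliques n)"
    using G by (auto simp: two_clique_class_iff)
  interpret graph G by fact
  have deg': "card {w. v \<rightarrow>\<^bsub>G\<^esub> w} = n - 1" if "v \<in> verts G" for v
    using deg[OF that] card_dominated by simp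
  show ?thesis
  proof
    fix S assume S: "S \<subseteq> verts G" "card S = n - 1 + 1"
    show "\<exists>u\<in>S. \<exists>w\<in>verts G - S. u \<rightarrow>\<^bsub>G\<^esub> w"
    proof (rule ccontr)
      assume closed: "\<not> ?thesis"
      have nbh: "{w. u \<rightarrow>\<^bsub>G\<^esub> w} = R - {u}"
        if R: "u \<in> R" "R \<subseteq> verts G" "card R = n" "{w. u \<rightarrow>\<^bsub>G\<^esub> w} \<subseteq> R" for u R
      proof (rule card_subset_eq)
        have "finite R" using R finite_verts finite_subset by blast
        then show "finite (R - {u})" by simp
        show "{w. u \<rightarrow>\<^bsub>G\<^esub> w} \<subseteq> R - {u}" using R adj_not_same by blast
        show "card {w. u \<rightarrow>\<^bsub>G\<^esub> w} = card (R - {u})" using deg'[of u] R \<open>finite R\<close> by auto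
      qed
      let ?T = "verts G - S"
      have cS: "card S = n" using S n by simp
      have cT: "card ?T = n" using S cS card finite_subset[OF S(1)] by (simp add: card_Diff_subset)
      have nS: "u \<rightarrow>\<^bsub>G\<^esub> w \<longleftrightarrow> w \<in> S - {u}" if "u \<in> S" for u w
        using nbh[OF that S(1) cS] closed that adj_in_verts by blast
      have nT: "u \<rightarrow>\<^bsub>G\<^esub> w \<longleftrightarrow> w \<in> ?T - {u}" if "u \<in> ?T" for u w
        using nbh[OF that _ cT] closed that adj_in_verts graph_symmetric by blast
      have "arcs_ends G = {(u, w). u \<noteq> w \<and> (u \<in> S \<and> w \<in> S \<or> u \<in> ?T \<and> w \<in> ?T)}"
        (is "_ = ?R")
      proof (rule set_eqI)
        fix e :: "'a \<times> 'a"
        obtain u w where e: "e = (u, w)" by fastforce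
        consider "u \<in> S" | "u \<in> ?T" | "u \<notin> verts G" by blast
        then show "e \<in> arcs_ends G \<longleftrightarrow> e \<in> ?R"
        proof cases
          case 1
          then show ?thesis using nS[of u w] e by auto
        next
          case 2
          then show ?thesis using nT[of u w] e by auto
        next
          case 3
          then show ?thesis using adj_in_verts(1)[of u w] S(1) e by auto
        qed
      qed
      then show False using digraph_iso_two_cliques[OF S(1) cS cT] niso by blast
    qed
  next
    show "card (verts G) = 2 * (n - 1) + 2" using card n by simp
  qed (use deg' graph_symmetric adj_not_same adj_in_verts in auto)
qed

theorem proposition5:
  fixes G :: "('a, 'b) pre_digraph" and n :: nat
  assumes "0 < n"
    and "G \<in> two_clique_class n"
  shows "two_connected G \<and> hamiltonian G"
proof
  interpret H: half_regular "verts G" "\<lambda>u v. u \<rightarrow>\<^bsub>G\<^esub> v" "n - 1"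
    using assms by (rule half_regular_if_two_clique_class)
  have gr: "graph G" using assms by (simp add: two_clique_class_iff)
  interpret graph G by fact
  have ne: "verts G \<noteq> {}" using H.order by auto
  show "two_connected G"
    unfolding two_connected_def
  proof (intro conjI ballI)
    show "connected G" using ne H.edge_leaving by (rule connected_if_edges_leave)
    fix v assume v: "v \<in> verts G"
    interpret D: wf_digraph "del_vert v" by (rule wf_digraph_del_vert)
    have ends: "u \<rightarrow>\<^bsub>del_vert v\<^esub> w \<longleftrightarrow> u \<rightarrow>\<^bsub>G\<^esub> w \<and> u \<noteq> v \<and> w \<noteq> v" for u w
      by (auto simp: arcs_ends_conv del_vert_simps)
    show "connected (del_vert v)"
    proof (rule D.connected_if_edges_leave)
      have "verts G \<noteq> {v}" using H.order by auto
      then show "verts (del_vert v) \<noteq> {}" using ne by (auto simp: verts_del_vert)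
    next
      fix S assume "S \<subseteq> verts (del_vert v)" "S \<noteq> {}" "S \<noteq> verts (del_vert v)"
      then show "\<exists>u\<in>S. \<exists>w\<in>verts (del_vert v) - S. u \<rightarrow>\<^bsub>del_vert v\<^esub> w"
        using H.edge_leaving_avoiding_vertex[OF v, of S] unfolding ends verts_del_vert by blast
    qed
  qed
  obtain cs where "H.cycle cs" "set cs = verts G" using H.ex_hamiltonian_cycle by blast
  then show "hamiltonian G"
    unfolding H.cycle_def H.path_def by (intro hamiltonian_if_vertex_cycle) auto
qed

end
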